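(* Let $n\ge 2$, let $C\in\mathbb{R}_+^{n\times n}$ be a cost matrix with $\|C\|_\infty:=\max_{i,j}C_{ij}>0$, let $r,c\in\Delta^n$, and let $\varepsilon>0$. Run the following procedure (the Greenkhorn-based approximation algorithm for optimal transport): (1) set $\eta=\varepsilon/(4\log n)$ and $\varepsilon'=\varepsilon/(8\|C\|_\infty)$; (2) set $\tilde r=(1-\varepsilon'/8)r+(\varepsilon'/(8n))\mathbf{1}_n$ and $\tilde c=(1-\varepsilon'/8)c+(\varepsilon'/(8n))\mathbf{1}_n$; (3) compute $\tilde X$ as the output of the Greenkhorn algorithm with input $(C,\eta,\tilde r,\tilde c)$ and tolerance $\varepsilon'/2$; (4) apply the rounding procedure to $\tilde X$ with target marginals $r,c$, obtaining $\hat X$. Then $\hat X\in\mathbb{R}_+^{n\times n}$ satisfies $\hat X\mathbf{1}_n=r$, $\hat X^\top\mathbf{1}_n=c$ and $\langle C,\hat X\rangle\le\langle C,X^*\rangle+\varepsilon$, where $X^*$ is an optimal solution of $\min\{\langle C,X\rangle: X\mathbf{1}_n=r,\ X^\top\mathbf{1}_n=c,\ X\ge 0\}$, and the total number of arithmetic operations is $\mathcal{O}\big(n^2\|C\|_\infty^2\log(n)\,\varepsilon^{-2}\big)$.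
   Context: $\Delta^n=\{u\in\mathbb{R}^n: u\ge 0,\ \sum_i u_i=1\}$; $\langle C,X\rangle=\sum_{i,j}C_{ij}X_{ij}$. For a matrix $F$, $r(F)=F\mathbf{1}_n$ and $c(F)=F^\top\mathbf{1}_n$ denote its row and column sums. Greenkhorn algorithm with input $(C,\eta,r,c)$ (here $r,c$ have strictly positive entries) and tolerance $\tau>0$: for $u,v\in\mathbb{R}^n$ let $B(u,v)\in\mathbb{R}^{n\times n}$ have entries $B(u,v)_{ij}=\exp(u_i+v_j-C_{ij}/\eta)$, and let $\rho(a,b)=b-a+a\log(a/b)$. Start with $u^0=v^0=0$, $t=0$. At step $t$ compute $E_t=\|r(B(u^t,v^t))-r\|_1+\|c(B(u^t,v^t))-c\|_1$; if $E_t\le\tau$ stop and output $B(u^t,v^t)$. Otherwise let $I\in\arg\max_i\rho(r_i,r_i(B(u^t,v^t)))$ and $J\in\arg\max_j\rho(c_j,c_j(B(u^t,v^t)))$. If $\rho(r_I,r_I(B(u^t,v^t)))>\rho(c_J,c_J(B(u^t,v^t)))$, set $u^{t+1}_I=u^t_I+\log r_I-\log r_I(B(u^t,v^t))$ and keep all other coordinates of $u$ and all of $v$ unchanged; otherwise set $v^{t+1}_J=v^t_J+\log c_J-\log c_J(B(u^t,v^t))$ and keep all other coordinates unchanged. Increase $t$ by one. Rounding procedure (input $F\in\mathbb{R}_{+}^{n\times n}$, targets $r,c\in\Delta^n$): let $x_i=\min\{r_i/r_i(F),1\}$, $F'=\mathrm{diag}(x)F$; let $y_j=\min\{c_j/c_j(F'),1\}$,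 $F''=F'\mathrm{diag}(y)$; let $e_r=r-r(F'')$, $e_c=c-c(F'')$; output $F''+e_re_c^\top/\|e_r\|_1$ (output $F''$ if $e_r=0$).
   Formalization: The operation bound is stated for ε ≤ 64‖C‖∞ (as ε→∞ the stated bound tends to 0 while at least n² operations are needed), and termination is stated when the smoothed marginals are strictly positive, which is automatic in that range; correctness holds for all ε > 0. *)

theory Defs
  imports
    Complex_Main
    "HOL-Library.While_Combinator"
    "HOL-Library.Monad_Syntax"
    "Jordan_Normal_Form.Matrix"
begin

section \<open>Discrete optimal transport problems\<close>

definition ones :: "nat \<Rightarrow> real vec" where
  "ones n = vec n (\<lambda>_. 1)"

definition prob_simplex :: "nat \<Rightarrow> real vec set" where
  "prob_simplex n = {u \<in> carrier_vec n. (\<forall>i<n. 0 \<le> u $ i) \<and> (\<Sum>i<n. u $ i) = 1}"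

definition nonneg_mats :: "nat \<Rightarrow> real mat set" where
  "nonneg_mats n = {X \<in> carrier_mat n n. \<forall>i<n. \<forall>j<n. 0 \<le> X $$ (i, j)}"

definition row_sums :: "real mat \<Rightarrow> real vec" where
  "row_sums F = F *\<^sub>v ones (dim_col F)"

definition col_sums :: "real mat \<Rightarrow> real vec" where
  "col_sums F = transpose_mat F *\<^sub>v ones (dim_row F)"

definition mat_inner :: "real mat \<Rightarrow> real mat \<Rightarrow> real" where
  "mat_inner C X = (\<Sum>i<dim_row C. \<Sum>j<dim_col C. C $$ (i, j) * X $$ (i, j))"

definition norm1 :: "real vec \<Rightarrow> real" where
  "norm1 x = (\<Sum>i<dim_vec x. \<bar>x $ i\<bar>)"

definition max_entry :: "real mat \<Rightarrow> real" where
  "max_entry C = Max (elements_mat C)"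

definition transport_plans :: "nat \<Rightarrow> real vec \<Rightarrow> real vec \<Rightarrow> real mat set" where
  "transport_plans n r c =
     {X \<in> nonneg_mats n. X *\<^sub>v ones n = r \<and> transpose_mat X *\<^sub>v ones n = c}"

definition optimal_plan :: "nat \<Rightarrow> real mat \<Rightarrow> real vec \<Rightarrow> real vec \<Rightarrow> real mat \<Rightarrow> bool" where
  "optimal_plan n C r c = is_arg_min (mat_inner C) (\<lambda>X. X \<in> transport_plans n r c)"


section \<open>The procedure\<close>

subsection \<open>Greenkhorn\<close>

definition scaled_kernel :: "real mat \<Rightarrow> real \<Rightarrow> real vec \<Rightarrow> real vec \<Rightarrow> real mat" where
  "scaled_kernel C \<eta> u v =
     mat (dim_row C) (dim_col C) (\<lambda>(i, j). exp (u $ i + v $ j - C $$ (i, j) / \<eta>))"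

definition rho :: "real \<Rightarrow> real \<Rightarrow> real" where
  "rho a b = b - a + a * ln (a / b)"

definition marginal_error :: "real mat \<Rightarrow> real vec \<Rightarrow> real vec \<Rightarrow> real" where
  "marginal_error F r c = norm1 (row_sums F - r) + norm1 (col_sums F - c)"

text \<open>A step is a relation because any maximisers \<open>I\<close>, \<open>J\<close> may be used.\<close>

definition greenkhorn_step ::
  "real mat \<Rightarrow> real \<Rightarrow> real vec \<Rightarrow> real vec \<Rightarrow> real vec \<times> real vec \<Rightarrow> real vec \<times> real vec \<Rightarrow> bool" where
  "greenkhorn_step C \<eta> r c = (\<lambda>(u, v) (u', v').
     let F = scaled_kernel C \<eta> u v; p = row_sums F; q = col_sums F in
     \<exists>I J. is_arg_max (\<lambda>i. rho (r $ i) (p $ i)) (\<lambda>i. i < dim_vec r) I \<and>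
           is_arg_max (\<lambda>j. rho (c $ j) (q $ j)) (\<lambda>j. j < dim_vec c) J \<and>
           (if rho (r $ I) (p $ I) > rho (c $ J) (q $ J)
            then u' = update_vec u I (u $ I + ln (r $ I) - ln (p $ I)) \<and> v' = v
            else u' = u \<and> v' = update_vec v J (v $ J + ln (c $ J) - ln (q $ J))))"

definition greenkhorn_iteration ::
  "real mat \<Rightarrow> real \<Rightarrow> real vec \<Rightarrow> real vec \<Rightarrow> real \<Rightarrow>
   real vec \<times> real vec \<Rightarrow> real vec \<times> real vec \<Rightarrow> bool" where
  "greenkhorn_iteration C \<eta> r c \<tau> s s' \<longleftrightarrow>
     \<not> marginal_error (scaled_kernel C \<eta> (fst s) (snd s)) r c \<le> \<tau> \<and> greenkhorn_step C \<eta> r c s s'"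

definition greenkhorn_start :: "real mat \<Rightarrow> real vec \<times> real vec" where
  "greenkhorn_start C = (0\<^sub>v (dim_row C), 0\<^sub>v (dim_col C))"

definition greenkhorn_outputs ::
  "real mat \<Rightarrow> real \<Rightarrow> real vec \<Rightarrow> real vec \<Rightarrow> real \<Rightarrow> real mat set" where
  "greenkhorn_outputs C \<eta> r c \<tau> =
     {scaled_kernel C \<eta> u v | u v.
        (greenkhorn_iteration C \<eta> r c \<tau>)\<^sup>*\<^sup>* (greenkhorn_start C) (u, v) \<and>
        marginal_error (scaled_kernel C \<eta> u v) r c \<le> \<tau>}"

definition greenkhorn_terminates ::
  "real mat \<Rightarrow> real \<Rightarrow> real vec \<Rightarrow> real vec \<Rightarrow> real \<Rightarrow> bool" where
  "greenkhorn_terminates C \<eta> r c \<tau> \<longleftrightarrow>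
     \<not> (\<exists>s. s 0 = greenkhorn_start C \<and>
           (\<forall>t::nat. greenkhorn_iteration C \<eta> r c \<tau> (s t) (s (Suc t))))"

subsection \<open>Rounding\<close>

definition round_to :: "real vec \<Rightarrow> real vec \<Rightarrow> real mat \<Rightarrow> real mat" where
  "round_to r c F =
    (let n = dim_vec r;
         F' = mat_diag n (\<lambda>i. min (r $ i / row_sums F $ i) 1) * F;
         F'' = F' * mat_diag n (\<lambda>j. min (c $ j / col_sums F' $ j) 1);
         e\<^sub>r = r - row_sums F'';
         e\<^sub>c = c - col_sums F''
     in if e\<^sub>r = 0\<^sub>v n then F''
        else F'' + mat n n (\<lambda>(i, j). e\<^sub>r $ i * e\<^sub>c $ j / norm1 e\<^sub>r))"

subsection \<open>Approximate optimal transport\<close>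

definition ot_eta :: "real mat \<Rightarrow> real \<Rightarrow> real" where
  "ot_eta C \<epsilon> = \<epsilon> / (4 * ln (real (dim_row C)))"

definition ot_eps :: "real mat \<Rightarrow> real \<Rightarrow> real" where
  "ot_eps C \<epsilon> = \<epsilon> / (8 * max_entry C)"

definition ot_smooth :: "real mat \<Rightarrow> real \<Rightarrow> real vec \<Rightarrow> real vec" where
  "ot_smooth C \<epsilon> r =
     (1 - ot_eps C \<epsilon> / 8) \<cdot>\<^sub>v r + (ot_eps C \<epsilon> / (8 * real (dim_vec r))) \<cdot>\<^sub>v ones (dim_vec r)"

definition ot_outputs :: "real mat \<Rightarrow> real vec \<Rightarrow> real vec \<Rightarrow> real \<Rightarrow> real mat set" where
  "ot_outputs C r c \<epsilon> =
     round_to r c ` greenkhorn_outputs C (ot_eta C \<epsilon>) (ot_smooth C \<epsilon> r) (ot_smooth C \<epsilon> c)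
                      (ot_eps C \<epsilon> / 2)"

text \<open>Greenkhorn takes logarithms of its target marginals, so these have to be positive. This
  is automatic as long as the smoothing weight \<open>ot_eps C \<epsilon> / 8\<close> is at most 1, and may fail
  otherwise.\<close>

definition positive_vec :: "real vec \<Rightarrow> bool" where
  "positive_vec x \<longleftrightarrow> (\<forall>i<dim_vec x. 0 < x $ i)"

lemma positive_vec_ot_smooth:
  assumes "r \<in> prob_simplex n" and "0 < max_entry C" and "0 < \<epsilon>" and "\<epsilon> \<le> 64 * max_entry C"
  shows "positive_vec (ot_smooth C \<epsilon> r)"
proof -
  have r: "dim_vec r = n" "\<And>i. i < n \<Longrightarrow> 0 \<le> r $ i"
    using assms(1) by (auto simp: prob_simplex_def)
  have e: "0 < ot_eps C \<epsilon>" "ot_eps C \<epsilon> \<le> 8"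
    using assms(2-4) by (auto simp: ot_eps_def field_simps)
  have "0 < (1 - ot_eps C \<epsilon> / 8) * r $ i + ot_eps C \<epsilon> / (8 * real n)" if "i < n" for i
    using e r(2)[OF that] that by (intro add_nonneg_pos mult_nonneg_nonneg) auto
  then show ?thesis
    by (auto simp: positive_vec_def ot_smooth_def ones_def r(1))
qed


section \<open>Counting arithmetic operations\<close>

text \<open>A computation returns its value together with the number of operations performed on real
  numbers: \<open>+\<close>, \<open>-\<close>, \<open>*\<close>, \<open>/\<close>, \<open>exp\<close>, \<open>ln\<close>, \<open>\<bar>_\<bar>\<close>, \<open>min\<close>, \<open>max\<close> and comparisons cost one each.
  Memory access and integer loop control are free.\<close>

type_synonym 'a counted = "'a \<times> nat"

definition ret :: "'a \<Rightarrow> 'a counted" where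
  "ret x = (x, 0)"

definition bind_counted :: "'a counted \<Rightarrow> ('a \<Rightarrow> 'b counted) \<Rightarrow> 'b counted" where
  "bind_counted m f = (fst (f (fst m)), snd m + snd (f (fst m)))"

adhoc_overloading Monad_Syntax.bind \<rightleftharpoons> bind_counted

definition op1 :: "('a \<Rightarrow> 'b) \<Rightarrow> 'a \<Rightarrow> 'b counted" where
  "op1 f x = (f x, 1)"

definition op2 :: "('a \<Rightarrow> 'b \<Rightarrow> 'c) \<Rightarrow> 'a \<Rightarrow> 'b \<Rightarrow> 'c counted" where
  "op2 f x y = (f x y, 1)"

abbreviation add_op :: "real \<Rightarrow> real \<Rightarrow> real counted" where "add_op \<equiv> op2 (+)"
abbreviation sub_op :: "real \<Rightarrow> real \<Rightarrow> real counted" where "sub_op \<equiv> op2 (-)"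
abbreviation mul_op :: "real \<Rightarrow> real \<Rightarrow> real counted" where "mul_op \<equiv> op2 (*)"
abbreviation div_op :: "real \<Rightarrow> real \<Rightarrow> real counted" where "div_op \<equiv> op2 (/)"
abbreviation min_op :: "real \<Rightarrow> real \<Rightarrow> real counted" where "min_op \<equiv> op2 min"
abbreviation max_op :: "real \<Rightarrow> real \<Rightarrow> real counted" where "max_op \<equiv> op2 max"
abbreviation less_op :: "real \<Rightarrow> real \<Rightarrow> bool counted" where "less_op \<equiv> op2 (<)"
abbreviation eq_op :: "real \<Rightarrow> real \<Rightarrow> bool counted" where "eq_op \<equiv> op2 (=)"
abbreviation abs_op :: "real \<Rightarrow> real counted" where "abs_op \<equiv> op1 abs"
abbreviation exp_op :: "real \<Rightarrow> real counted" where "exp_op \<equiv> op1 exp"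
abbreviation ln_op :: "real \<Rightarrow> real counted" where "ln_op \<equiv> op1 ln"

primrec for_loop :: "nat \<Rightarrow> (nat \<Rightarrow> 's \<Rightarrow> 's counted) \<Rightarrow> 's \<Rightarrow> 's counted" where
  "for_loop 0 f s = ret s"
| "for_loop (Suc k) f s = do { s' \<leftarrow> for_loop k f s; f k s' }"

definition while_loop ::
  "('s \<Rightarrow> bool counted) \<Rightarrow> ('s \<Rightarrow> 's counted) \<Rightarrow> 's \<Rightarrow> 's counted option" where
  "while_loop b f s =
     map_option (\<lambda>(s, k). (s, k + snd (b s)))
       (while_option (\<lambda>(s, k). fst (b s))
          (\<lambda>(s, k). (fst (f s), k + snd (b s) + snd (f s))) (s, 0))"

definition tabulate_vec :: "nat \<Rightarrow> (nat \<Rightarrow> real counted) \<Rightarrow> real vec counted" where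
  "tabulate_vec n f = (vec n (\<lambda>i. fst (f i)), \<Sum>i<n. snd (f i))"

definition tabulate_mat ::
  "nat \<Rightarrow> nat \<Rightarrow> (nat \<Rightarrow> nat \<Rightarrow> real counted) \<Rightarrow> real mat counted" where
  "tabulate_mat m n f = (mat m n (\<lambda>(i, j). fst (f i j)), \<Sum>i<m. \<Sum>j<n. snd (f i j))"

definition sum_prog :: "nat \<Rightarrow> (nat \<Rightarrow> real counted) \<Rightarrow> real counted" where
  "sum_prog n f = for_loop n (\<lambda>i s. do { x \<leftarrow> f i; add_op s x }) 0"

definition row_sums_prog :: "nat \<Rightarrow> real mat \<Rightarrow> real vec counted" where
  "row_sums_prog n F = tabulate_vec n (\<lambda>i. sum_prog n (\<lambda>j. ret (F $$ (i, j))))"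

definition col_sums_prog :: "nat \<Rightarrow> real mat \<Rightarrow> real vec counted" where
  "col_sums_prog n F = tabulate_vec n (\<lambda>j. sum_prog n (\<lambda>i. ret (F $$ (i, j))))"

definition max_entry_prog :: "nat \<Rightarrow> real mat \<Rightarrow> real counted" where
  "max_entry_prog n C =
     for_loop n (\<lambda>i. for_loop n (\<lambda>j m. max_op m (C $$ (i, j)))) (C $$ (0, 0))"

text \<open>Linear search for a maximiser. The predicate \<open>tie\<close> says when to move on to an equally
  good index; every maximiser is found for a suitable \<open>tie\<close>.\<close>

definition argmax_prog :: "(nat \<Rightarrow> bool) \<Rightarrow> nat \<Rightarrow> real vec \<Rightarrow> nat counted" where
  "argmax_prog tie n x = for_loop n (\<lambda>i best. do {
     gt \<leftarrow> less_op (x $ best) (x $ i);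
     eq \<leftarrow> eq_op (x $ best) (x $ i);
     ret (if gt \<or> eq \<and> tie i then i else best) }) 0"

subsection \<open>Greenkhorn with maintained row and column sums\<close>

definition kernel_entry_prog ::
  "real mat \<Rightarrow> real \<Rightarrow> real vec \<Rightarrow> real vec \<Rightarrow> nat \<Rightarrow> nat \<Rightarrow> real counted" where
  "kernel_entry_prog C \<eta> u v i j = do {
     a \<leftarrow> add_op (u $ i) (v $ j);
     b \<leftarrow> div_op (C $$ (i, j)) \<eta>;
     d \<leftarrow> sub_op a b;
     exp_op d }"

definition rho_prog :: "real \<Rightarrow> real \<Rightarrow> real counted" where
  "rho_prog a b = do {
     d \<leftarrow> sub_op b a;
     q \<leftarrow> div_op a b;
     l \<leftarrow> ln_op q;
     m \<leftarrow> mul_op a l;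
     add_op d m }"

definition dist1_prog :: "nat \<Rightarrow> real vec \<Rightarrow> real vec \<Rightarrow> real counted" where
  "dist1_prog n x y = sum_prog n (\<lambda>i. do { d \<leftarrow> sub_op (x $ i) (y $ i); abs_op d })"

definition error_prog ::
  "nat \<Rightarrow> real vec \<Rightarrow> real vec \<Rightarrow> real vec \<Rightarrow> real vec \<Rightarrow> real counted" where
  "error_prog n r c p q = do {
     a \<leftarrow> dist1_prog n p r;
     b \<leftarrow> dist1_prog n q c;
     add_op a b }"

text \<open>State: number of iterations, \<open>u\<close>, \<open>v\<close>, the current matrix \<open>F\<close>, its row sums \<open>p\<close>, its
  column sums \<open>q\<close>, and the current marginal error. An iteration changes one row or one column
  of \<open>F\<close>, so \<open>p\<close> and \<open>q\<close> can be updated without recomputing them from \<open>F\<close>.\<close>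

type_synonym gk_state =
  "nat \<times> real vec \<times> real vec \<times> real mat \<times> real vec \<times> real vec \<times> real"

definition gk_init :: "nat \<Rightarrow> real mat \<Rightarrow> real \<Rightarrow> real vec \<Rightarrow> real vec \<Rightarrow> gk_state counted" where
  "gk_init n C \<eta> r c = do {
     let u = 0\<^sub>v n;
     let v = 0\<^sub>v n;
     F \<leftarrow> tabulate_mat n n (kernel_entry_prog C \<eta> u v);
     p \<leftarrow> row_sums_prog n F;
     q \<leftarrow> col_sums_prog n F;
     e \<leftarrow> error_prog n r c p q;
     ret (0, u, v, F, p, q, e) }"

definition gk_row_update ::
  "nat \<Rightarrow> real mat \<Rightarrow> real \<Rightarrow> real vec \<Rightarrow> real vec \<Rightarrow> nat \<Rightarrow> gk_state \<Rightarrow> gk_state counted" where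
  "gk_row_update n C \<eta> r c I = (\<lambda>(t, u, v, F, p, q, _). do {
     l \<leftarrow> ln_op (r $ I);
     l' \<leftarrow> ln_op (p $ I);
     a \<leftarrow> add_op (u $ I) l;
     a' \<leftarrow> sub_op a l';
     let u' = update_vec u I a';
     x \<leftarrow> tabulate_vec n (\<lambda>j. kernel_entry_prog C \<eta> u' v I j);
     s \<leftarrow> sum_prog n (\<lambda>j. ret (x $ j));
     let p' = update_vec p I s;
     q' \<leftarrow> tabulate_vec n (\<lambda>j. do { d \<leftarrow> sub_op (q $ j) (F $$ (I, j)); add_op d (x $ j) });
     let F' = mat n n (\<lambda>(i, j). if i = I then x $ j else F $$ (i, j));
     e \<leftarrow> error_prog n r c p' q';
     ret (Suc t, u', v, F', p', q', e) })"

definition gk_col_update ::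
  "nat \<Rightarrow> real mat \<Rightarrow> real \<Rightarrow> real vec \<Rightarrow> real vec \<Rightarrow> nat \<Rightarrow> gk_state \<Rightarrow> gk_state counted" where
  "gk_col_update n C \<eta> r c J = (\<lambda>(t, u, v, F, p, q, _). do {
     l \<leftarrow> ln_op (c $ J);
     l' \<leftarrow> ln_op (q $ J);
     a \<leftarrow> add_op (v $ J) l;
     a' \<leftarrow> sub_op a l';
     let v' = update_vec v J a';
     x \<leftarrow> tabulate_vec n (\<lambda>i. kernel_entry_prog C \<eta> u v' i J);
     s \<leftarrow> sum_prog n (\<lambda>i. ret (x $ i));
     let q' = update_vec q J s;
     p' \<leftarrow> tabulate_vec n (\<lambda>i. do { d \<leftarrow> sub_op (p $ i) (F $$ (i, J)); add_op d (x $ i) });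
     let F' = mat n n (\<lambda>(i, j). if j = J then x $ i else F $$ (i, j));
     e \<leftarrow> error_prog n r c p' q';
     ret (Suc t, u, v', F', p', q', e) })"

definition gk_body ::
  "(nat \<Rightarrow> nat \<Rightarrow> bool) \<Rightarrow> (nat \<Rightarrow> nat \<Rightarrow> bool) \<Rightarrow> nat \<Rightarrow> real mat \<Rightarrow> real \<Rightarrow> real vec \<Rightarrow> real vec \<Rightarrow>
   gk_state \<Rightarrow> gk_state counted" where
  "gk_body row_tie col_tie n C \<eta> r c = (\<lambda>(t, u, v, F, p, q, e). do {
     x \<leftarrow> tabulate_vec n (\<lambda>i. rho_prog (r $ i) (p $ i));
     y \<leftarrow> tabulate_vec n (\<lambda>j. rho_prog (c $ j) (q $ j));
     I \<leftarrow> argmax_prog (row_tie t) n x;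
     J \<leftarrow> argmax_prog (col_tie t) n y;
     b \<leftarrow> less_op (y $ J) (x $ I);
     if b then gk_row_update n C \<eta> r c I (t, u, v, F, p, q, e)
     else gk_col_update n C \<eta> r c J (t, u, v, F, p, q, e) })"

definition greenkhorn_prog ::
  "(nat \<Rightarrow> nat \<Rightarrow> bool) \<Rightarrow> (nat \<Rightarrow> nat \<Rightarrow> bool) \<Rightarrow> nat \<Rightarrow> real mat \<Rightarrow> real \<Rightarrow> real vec \<Rightarrow> real vec \<Rightarrow>
   real \<Rightarrow> real mat counted option" where
  "greenkhorn_prog row_tie col_tie n C \<eta> r c \<tau> =
    (let (s\<^sub>0, k\<^sub>0) = gk_init n C \<eta> r c in
     map_option (\<lambda>((t, u, v, F, p, q, e), k). (F, k\<^sub>0 + k))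
       (while_loop (\<lambda>(t, u, v, F, p, q, e). less_op \<tau> e)
          (gk_body row_tie col_tie n C \<eta> r c) s\<^sub>0))"

subsection \<open>Rounding and the complete procedure\<close>

definition round_prog :: "nat \<Rightarrow> real vec \<Rightarrow> real vec \<Rightarrow> real mat \<Rightarrow> real mat counted" where
  "round_prog n r c F = do {
     p \<leftarrow> row_sums_prog n F;
     x \<leftarrow> tabulate_vec n (\<lambda>i. do { d \<leftarrow> div_op (r $ i) (p $ i); min_op d 1 });
     F' \<leftarrow> tabulate_mat n n (\<lambda>i j. mul_op (x $ i) (F $$ (i, j)));
     q \<leftarrow> col_sums_prog n F';
     y \<leftarrow> tabulate_vec n (\<lambda>j. do { d \<leftarrow> div_op (c $ j) (q $ j); min_op d 1 });
     F'' \<leftarrow> tabulate_mat n n (\<lambda>i j. mul_op (F' $$ (i, j)) (y $ j));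
     p'' \<leftarrow> row_sums_prog n F'';
     q'' \<leftarrow> col_sums_prog n F'';
     e\<^sub>r \<leftarrow> tabulate_vec n (\<lambda>i. sub_op (r $ i) (p'' $ i));
     e\<^sub>c \<leftarrow> tabulate_vec n (\<lambda>j. sub_op (c $ j) (q'' $ j));
     s \<leftarrow> sum_prog n (\<lambda>i. abs_op (e\<^sub>r $ i));
     z \<leftarrow> eq_op s 0;
     if z then ret F''
     else tabulate_mat n n (\<lambda>i j. do {
       a \<leftarrow> mul_op (e\<^sub>r $ i) (e\<^sub>c $ j);
       b \<leftarrow> div_op a s;
       add_op (F'' $$ (i, j)) b }) }"

text \<open>Returns \<open>\<eta>\<close>, the two smoothed marginals and the tolerance.\<close>

definition setup_prog ::
  "nat \<Rightarrow> real mat \<Rightarrow> real vec \<Rightarrow> real vec \<Rightarrow> real \<Rightarrow> (real \<times> real vec \<times> real vec \<times> real) counted"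
where
  "setup_prog n C r c \<epsilon> = do {
     l \<leftarrow> ln_op (real n);
     l' \<leftarrow> mul_op 4 l;
     \<eta> \<leftarrow> div_op \<epsilon> l';
     m \<leftarrow> max_entry_prog n C;
     m' \<leftarrow> mul_op 8 m;
     \<epsilon>' \<leftarrow> div_op \<epsilon> m';
     w \<leftarrow> div_op \<epsilon>' 8;
     w' \<leftarrow> sub_op 1 w;
     d \<leftarrow> mul_op 8 (real n);
     z \<leftarrow> div_op \<epsilon>' d;
     r' \<leftarrow> tabulate_vec n (\<lambda>i. do { a \<leftarrow> mul_op w' (r $ i); add_op a z });
     c' \<leftarrow> tabulate_vec n (\<lambda>j. do { a \<leftarrow> mul_op w' (c $ j); add_op a z });
     \<tau> \<leftarrow> div_op \<epsilon>' 2;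
     ret (\<eta>, r', c', \<tau>) }"

text \<open>The result is \<open>None\<close> if the loop diverges, and otherwise the computed matrix together with
  the total number of operations.\<close>

definition ot_prog ::
  "(nat \<Rightarrow> nat \<Rightarrow> bool) \<Rightarrow> (nat \<Rightarrow> nat \<Rightarrow> bool) \<Rightarrow> nat \<Rightarrow> real mat \<Rightarrow> real vec \<Rightarrow> real vec \<Rightarrow> real \<Rightarrow>
   real mat counted option" where
  "ot_prog row_tie col_tie n C r c \<epsilon> =
    (let ((\<eta>, r', c', \<tau>), k\<^sub>1) = setup_prog n C r c \<epsilon> in
     map_option (\<lambda>(F, k\<^sub>2). let (X, k\<^sub>3) = round_prog n r c F in (X, k\<^sub>1 + k\<^sub>2 + k\<^sub>3))
       (greenkhorn_prog row_tie col_tie n C \<eta> r' c' \<tau>))"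

end

theory Submission
  imports Defs "HOL-Analysis.Function_Topology"
begin

text \<open>
  \<^bold>\<open>Quality.\<close> The matrix \<open>F\<close> returned by Greenkhorn has Gibbs form, so it is optimal for the
  entropically regularised problem with its own marginals. Rounding an optimal plan to the
  marginals of \<open>F\<close> gives a competitor, and rounding \<open>F\<close> to the marginals \<open>r\<close>, \<open>c\<close> gives the output.
  Since the cost is nonnegative, each rounding costs at most \<open>max_entry C\<close> times half of the
  marginal error, and the entropy term costs at most about \<open>\<epsilon> / 2\<close>. If \<open>\<epsilon> \<ge> max_entry C\<close>, every plan
  is good enough.

  \<^bold>\<open>Iterations.\<close> Let \<open>D\<close> be the gap of the dual potential to its minimum, \<open>E\<close> the marginal error and
  \<open>R\<close> a bound on the sup norm of a dual optimum. A coordinate update does not increase the sup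
  distance to the optimum, so convexity gives \<open>D \<le> R * E\<close>. A greedy step decreases \<open>D\<close> by at
  least a multiple of \<open>E\<^sup>2 / n\<close> if \<open>E \<le> 2\<close>, and of \<open>E / n\<close> otherwise. Hence there are \<open>O(n ln n + n R / \<tau>)\<close>
  steps with \<open>E > \<tau>\<close>, and each of them takes \<open>O(n)\<close> operations.
\<close>

section \<open>The dual potential\<close>

text \<open>This has two consequences. The lower bound for the decrease is linear in the error, with
  a free slope that is tuned afterwards. And the gap needs a second upper bound,
  \<open>D \<le> E / 2 + 2 * R\<close>: while the mass is large, \<open>D \<le> R * E\<close> alone
  would lose a factor \<open>R\<close> in the rate. The value of \<open>R\<close> explains the
  smoothing of the marginals. A vanishing marginal admits no finite dual optimum, whereas marginals
  bounded below by \<open>m\<close> admit one of sup norm at most \<open>M - ln m\<close>, where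
  \<open>M\<close> is the largest cost divided by \<eta>. With \<kappa> =
  \<open>max_entry C / \<epsilon>\<close>, \<open>M\<close> is 4 \<kappa> ln n and 1 / \<tau> is of
  order \<kappa>, so n R / \<tau> is of order n \<kappa>^2 ln n.\<close>

lemma rho_pos:
  assumes "0 < a" and "0 < b" and "a \<noteq> b"
  shows "0 < rho a b"
proof -
  have "ln (b / a) \<noteq> b / a - 1"
    using assms ln_eq_minus_one[of "b / a"] by auto
  then have "ln (b / a) < b / a - 1"
    using assms ln_le_minus_one[of "b / a"] by (simp add: order_less_le)
  then have "a * ln (b / a) < b - a"
    using assms by (simp add: field_simps)
  then show ?thesis
    using assms by (simp add: rho_def ln_div algebra_simps)
qed

text \<open>A linearised Pinsker inequality. Since it is linear in \<open>\<bar>a - b\<bar>\<close>, it can be summed without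
  any assumption on the total mass of the second argument.\<close>

lemma abs_diff_le_rho:
  assumes "0 < a" and "0 < b" and "0 \<le> \<theta>" and "\<theta> \<le> 1 / 2"
  shows "\<theta> * \<bar>a - b\<bar> \<le> rho a b + 2 * \<theta>\<^sup>2 * a"
proof -
  \<comment> \<open>In Legendre form, \<open>rho a b\<close> is the supremum over
    \<open>y > 0\<close> of \<open>(1 - y) * b + a * ln y\<close>, attained at
    \<open>y = a / b\<close>. The choices \<open>1 - \<theta>\<close> and
    \<open>1 + \<theta>\<close> for \<open>y\<close> give the slopes \<theta> and -\<theta> in
    \<open>b\<close>.\<close>
  have tangent: "a * ln y + a * ln b - a * ln a \<le> y * b - a" if "0 < y" for y
  proof -
    have "ln (y * b / a) \<le> y * b / a - 1"
      using assms that by (intro ln_le_minus_one) auto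
    then have "a * ln (y * b / a) \<le> a * (y * b / a - 1)"
      using assms by (intro mult_left_mono) auto
    also have "a * (y * b / a - 1) = y * b - a"
      using assms by (simp add: field_simps)
    finally show ?thesis
      using assms that by (simp add: ln_div ln_mult algebra_simps)
  qed
  have rho: "rho a b = b - a + a * ln a - a * ln b"
    using assms by (simp add: rho_def ln_div algebra_simps)
  show ?thesis
  proof (cases "a \<le> b")
    case True
    have "a * (- \<theta> - 2 * \<theta>\<^sup>2) \<le> a * ln (1 - \<theta>)"
      using assms ln_one_minus_pos_lower_bound[of \<theta>] by (intro mult_left_mono) auto
    then show ?thesis
      using tangent[of "1 - \<theta>"] assms True by (simp add: rho algebra_simps)
  next
    case False
    have "a * (\<theta> - \<theta>\<^sup>2) \<le> a * ln (1 + \<theta>)"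
      using assms ln_one_plus_pos_lower_bound[of \<theta>] by (intro mult_left_mono) auto
    moreover have "0 \<le> \<theta>\<^sup>2 * a"
      using assms(1) by simp
    moreover have "0 < 1 + \<theta>"
      using assms(3) by simp
    ultimately show ?thesis
      using tangent[of "1 + \<theta>"] False unfolding rho
      by (simp add: right_diff_distrib left_diff_distrib distrib_left distrib_right mult_ac)
  qed
qed

text \<open>Potentials will be functions on all of \<open>nat\<close>, so the box in which the dual
  potential is minimised is an infinite product; its compactness is Tychonoff's theorem.\<close>

lemma compact_PiE_UNIV:
  fixes S :: "'a \<Rightarrow> 'b::topological_space set"
  assumes "\<And>i. compact (S i)"
  shows "compact (PiE UNIV S)"
proof -
  have "compactin (product_topology (\<lambda>_. euclidean) UNIV) (PiE UNIV S)"
    using assms by (simp add: compactin_PiE)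
  then show ?thesis
    by (simp add: euclidean_product_topology)
qed

lemma sum_update_diff:
  fixes f g :: "'a \<Rightarrow> 'b::ab_group_add"
  assumes "finite A" and "k \<in> A" and "\<And>i. i \<in> A \<Longrightarrow> i \<noteq> k \<Longrightarrow> g i = f i"
  shows "sum g A = sum f A - f k + g k"
proof -
  have "sum g (A - {k}) = sum f (A - {k})"
    using assms(3) by (intro sum.cong) auto
  then show ?thesis
    using assms by (simp add: sum.remove)
qed

text \<open>\<open>a\<close> stands for the cost divided by \<eta>. Functions on \<open>nat\<close>
  replace vectors and matrices: they carry the product topology, and the transposed problem is again
  an instance of the locale.\<close>

locale gibbs_scaling =
  fixes n :: nat and a :: "nat \<Rightarrow> nat \<Rightarrow> real" and M :: real and r c :: "nat \<Rightarrow> real"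
  assumes a_nonneg: "\<And>i j. i < n \<Longrightarrow> j < n \<Longrightarrow> 0 \<le> a i j"
    and a_le: "\<And>i j. i < n \<Longrightarrow> j < n \<Longrightarrow> a i j \<le> M"
    and r_pos: "\<And>i. i < n \<Longrightarrow> 0 < r i"
    and c_pos: "\<And>j. j < n \<Longrightarrow> 0 < c j"
    and r_sum: "(\<Sum>i<n. r i) = 1"
    and c_sum: "(\<Sum>j<n. c j) = 1"
begin

definition kern :: "(nat \<Rightarrow> real) \<Rightarrow> (nat \<Rightarrow> real) \<Rightarrow> nat \<Rightarrow> nat \<Rightarrow> real" where
  "kern u v i j = exp (u i + v j - a i j)"

definition rsum :: "(nat \<Rightarrow> real) \<Rightarrow> (nat \<Rightarrow> real) \<Rightarrow> nat \<Rightarrow> real" where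
  "rsum u v i = (\<Sum>j<n. kern u v i j)"

definition csum :: "(nat \<Rightarrow> real) \<Rightarrow> (nat \<Rightarrow> real) \<Rightarrow> nat \<Rightarrow> real" where
  "csum u v j = (\<Sum>i<n. kern u v i j)"

text \<open>The negative of the entropic dual objective, up to constants. It is convex with gradient
  \<open>rsum u v - r\<close> in \<open>u\<close> and \<open>csum u v - c\<close> in
  \<open>v\<close>, so its critical points are the scalings with marginals \<open>r\<close> and
  \<open>c\<close>.\<close>

definition pot :: "(nat \<Rightarrow> real) \<Rightarrow> (nat \<Rightarrow> real) \<Rightarrow> real" where
  "pot u v = (\<Sum>i<n. rsum u v i) - (\<Sum>i<n. r i * u i) - (\<Sum>j<n. c j * v j)"

definition err :: "(nat \<Rightarrow> real) \<Rightarrow> (nat \<Rightarrow> real) \<Rightarrow> real" where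
  "err u v = (\<Sum>i<n. \<bar>rsum u v i - r i\<bar>) + (\<Sum>j<n. \<bar>csum u v j - c j\<bar>)"

definition total_rho :: "(nat \<Rightarrow> real) \<Rightarrow> (nat \<Rightarrow> real) \<Rightarrow> real" where
  "total_rho u v = (\<Sum>i<n. rho (r i) (rsum u v i)) + (\<Sum>j<n. rho (c j) (csum u v j))"

text \<open>A relation that speaks only about coordinates below \<open>n\<close>, because the
  functions will come from vectors, whose entries beyond the dimension are unspecified.\<close>

definition row_update ::
  "nat \<Rightarrow> (nat \<Rightarrow> real) \<Rightarrow> (nat \<Rightarrow> real) \<Rightarrow> (nat \<Rightarrow> real) \<Rightarrow> (nat \<Rightarrow> real) \<Rightarrow> bool" where
  "row_update I u v u' v' \<longleftrightarrow> I < n \<and>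
     (\<forall>i<n. u' i = (if i = I then u I + ln (r I) - ln (rsum u v I) else u i)) \<and>
     (\<forall>j<n. v' j = v j)"

definition col_update ::
  "nat \<Rightarrow> (nat \<Rightarrow> real) \<Rightarrow> (nat \<Rightarrow> real) \<Rightarrow> (nat \<Rightarrow> real) \<Rightarrow> (nat \<Rightarrow> real) \<Rightarrow> bool" where
  "col_update J u v u' v' \<longleftrightarrow> J < n \<and>
     (\<forall>i<n. u' i = u i) \<and>
     (\<forall>j<n. v' j = (if j = J then v J + ln (c J) - ln (csum u v J) else v j))"

definition greedy_step ::
  "(nat \<Rightarrow> real) \<Rightarrow> (nat \<Rightarrow> real) \<Rightarrow> (nat \<Rightarrow> real) \<Rightarrow> (nat \<Rightarrow> real) \<Rightarrow> bool" where
  "greedy_step u v u' v' \<longleftrightarrow> (\<exists>I J. I < n \<and> J < n \<and>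
     (\<forall>i<n. rho (r i) (rsum u v i) \<le> rho (r I) (rsum u v I)) \<and>
     (\<forall>j<n. rho (c j) (csum u v j) \<le> rho (c J) (csum u v J)) \<and>
     (if rho (r I) (rsum u v I) > rho (c J) (csum u v J)
      then row_update I u v u' v' else col_update J u v u' v'))"

lemma n_pos: "0 < n"
  using r_sum by (cases n) auto

lemma kern_pos [simp]: "0 < kern u v i j"
  by (simp add: kern_def)

lemma rsum_pos: "0 < rsum u v i"
  unfolding rsum_def using n_pos by (intro sum_pos) auto

lemma csum_pos: "0 < csum u v j"
  unfolding csum_def using n_pos by (intro sum_pos) auto

lemma sum_rsum_eq_sum_csum: "(\<Sum>i<n. rsum u v i) = (\<Sum>j<n. csum u v j)"
  unfolding rsum_def csum_def by (rule sum.swap)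

text \<open>Swapping the marginals and transposing the cost exchanges rows and columns. Each column
  statement below is obtained from its row counterpart by this interpretation.\<close>

lemma transposed: "gibbs_scaling n (\<lambda>i j. a j i) M c r"
  using a_nonneg a_le r_pos c_pos r_sum c_sum by unfold_locales auto

lemma transposed_simps:
  "gibbs_scaling.rsum n (\<lambda>i j. a j i) v u = csum u v"
  "gibbs_scaling.csum n (\<lambda>i j. a j i) v u = rsum u v"
  "gibbs_scaling.pot n (\<lambda>i j. a j i) c r v u = pot u v"
proof -
  interpret T: gibbs_scaling n "\<lambda>i j. a j i" M c r
    by (rule transposed)
  have k: "T.kern v u j i = kern u v i j" for i j
    by (simp add: T.kern_def kern_def algebra_simps)
  show rs: "T.rsum v u = csum u v" and "T.csum v u = rsum u v"
    by (simp_all add: fun_eq_iff T.rsum_def T.csum_def rsum_def csum_def k)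
  show "T.pot v u = pot u v"
    by (simp add: T.pot_def pot_def rs sum_rsum_eq_sum_csum)
qed

lemma transposed_col_update:
  "gibbs_scaling.row_update n (\<lambda>i j. a j i) c J v u v' u' \<longleftrightarrow> col_update J u v u' v'"
proof -
  interpret T: gibbs_scaling n "\<lambda>i j. a j i" M c r
    by (rule transposed)
  show ?thesis
    unfolding T.row_update_def col_update_def by (auto simp: transposed_simps)
qed

text \<open>The update minimises \<open>pot\<close> exactly in one coordinate: the row sum becomes
  \<open>r I\<close>, so the mass changes by \<open>r I - rsum u v I\<close>, the linear part by
  \<open>r I\<close> times the logarithmic step, and together this is \<open>rho\<close>.\<close>

lemma pot_row_update:
  assumes "row_update I u v u' v'"
  shows "pot u' v' = pot u v - rho (r I) (rsum u v I)"
proof -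
  have I: "I < n" and u': "\<And>i. i < n \<Longrightarrow> i \<noteq> I \<Longrightarrow> u' i = u i"
    and u'I: "u' I = u I + ln (r I) - ln (rsum u v I)" and v': "\<And>j. j < n \<Longrightarrow> v' j = v j"
    using assms by (auto simp: row_update_def)
  have same: "rsum u' v' i = rsum u v i" if "i < n" "i \<noteq> I" for i
    unfolding rsum_def kern_def by (rule sum.cong) (simp_all add: u' v' that)
  have "kern u' v' I j = kern u v I j * (r I / rsum u v I)" if "j < n" for j
    using r_pos[OF I] rsum_pos[of u v I]
    by (simp add: kern_def u'I v' that exp_add exp_diff mult_ac)
  then have "rsum u' v' I = rsum u v I * (r I / rsum u v I)"
    unfolding rsum_def[of u' v'] rsum_def[of u v I] sum_distrib_right
    by (simp add: rsum_def)
  then have new: "rsum u' v' I = r I"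
    using rsum_pos[of u v I] by simp
  have "(\<Sum>i<n. rsum u' v' i) = (\<Sum>i<n. rsum u v i) - rsum u v I + r I"
    using I same new by (subst sum_update_diff[of _ I _ "rsum u v"]) auto
  moreover have "(\<Sum>i<n. r i * u' i) = (\<Sum>i<n. r i * u i) - r I * u I + r I * u' I"
    using I u' by (intro sum_update_diff) auto
  moreover have "(\<Sum>j<n. c j * v' j) = (\<Sum>j<n. c j * v j)"
    using v' by (intro sum.cong) auto
  ultimately show ?thesis
    using r_pos[OF I] rsum_pos[of u v I]
    by (simp add: pot_def rho_def u'I ln_div algebra_simps)
qed

lemma pot_col_update:
  assumes "col_update J u v u' v'"
  shows "pot u' v' = pot u v - rho (c J) (csum u v J)"
proof -
  interpret T: gibbs_scaling n "\<lambda>i j. a j i" M c r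
    by (rule transposed)
  show ?thesis
    using T.pot_row_update[of J v u v' u'] assms by (simp add: transposed_simps transposed_col_update)
qed

text \<open>First-order convexity from \<open>1 + x \<le> exp x\<close>. Taken at an optimum, the
  gradient vanishes and the gap is nonnegative; taken at an iterate, it bounds the gap by
  displacement times marginal error.\<close>

lemma pot_convex:
  "pot u v - pot u' v' \<le>
     (\<Sum>i<n. (u i - u' i) * (rsum u v i - r i)) + (\<Sum>j<n. (v j - v' j) * (csum u v j - c j))"
proof -
  have "kern u v i j * (1 + (u' i - u i) + (v' j - v j)) \<le> kern u' v' i j" for i j
  proof -
    have "1 + ((u' i - u i) + (v' j - v j)) \<le> exp ((u' i - u i) + (v' j - v j))"
      by (rule exp_ge_add_one_self)
    then have "kern u v i j * (1 + ((u' i - u i) + (v' j - v j))) \<le>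
        kern u v i j * exp ((u' i - u i) + (v' j - v j))"
      by (intro mult_left_mono) (simp_all add: less_imp_le)
    also have "\<dots> = kern u' v' i j"
      by (simp add: kern_def flip: exp_add)
    finally show ?thesis
      by (simp add: algebra_simps)
  qed
  then have "(\<Sum>i<n. \<Sum>j<n. kern u v i j * (1 + (u' i - u i) + (v' j - v j))) \<le>
      (\<Sum>i<n. rsum u' v' i)"
    unfolding rsum_def by (intro sum_mono)
  moreover have "(\<Sum>i<n. \<Sum>j<n. kern u v i j * (1 + (u' i - u i) + (v' j - v j))) =
      (\<Sum>i<n. rsum u v i) + (\<Sum>i<n. (u' i - u i) * rsum u v i) +
      (\<Sum>j<n. (v' j - v j) * csum u v j)"
  proof -
    have "(\<Sum>j<n. (v' j - v j) * csum u v j) = (\<Sum>i<n. \<Sum>j<n. (v' j - v j) * kern u v i j)"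
      unfolding csum_def sum_distrib_left by (rule sum.swap)
    then show ?thesis
      by (simp add: rsum_def sum_distrib_left sum.distrib[symmetric] algebra_simps)
  qed
  ultimately show ?thesis
    by (simp add: pot_def algebra_simps sum.distrib sum_subtractf)
qed

section \<open>Coercivity and existence of an optimal scaling\<close>

lemma kern_exponent_bounded:
  assumes "0 \<le> Q" and "pot u v \<le> Q" and ij: "i < n" "j < n"
  shows "\<bar>u i + v j - a i j\<bar> \<le> (Q + M) / (r i * c j)"
proof -
  define x where "x i j = u i + v j - a i j" for i j
  \<comment> \<open>The product weights have total mass 1 and marginals \<open>r\<close> and
    \<open>c\<close>, so they turn the linear part of \<open>pot\<close> into a sum over entries.
    Then \<open>pot + \<Sum> w a\<close> is a sum of terms \<open>exp x - w x\<close>, all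
    nonnegative because \<open>w \<le> 1\<close>, and each single term is at most
    \<open>Q + M\<close>.\<close>
  define w where "w i j = r i * c j" for i j
  have w: "0 < w i j" "w i j \<le> 1" if "i < n" "j < n" for i j
  proof -
    have "r i \<le> (\<Sum>i<n. r i)" "c j \<le> (\<Sum>j<n. c j)"
      using that r_pos c_pos by (intro member_le_sum; force)+
    then show "w i j \<le> 1"
      using that r_pos[of i] c_pos[of j] mult_mono[of "r i" 1 "c j" 1]
      by (simp add: w_def r_sum c_sum)
    show "0 < w i j"
      using that r_pos c_pos by (simp add: w_def)
  qed
  have w_sum: "(\<Sum>i<n. \<Sum>j<n. w i j) = 1"
    by (simp add: w_def r_sum c_sum flip: sum_distrib_left)
  have term_nonneg: "0 \<le> exp (x i j) - w i j * x i j" if "i < n" "j < n" for i j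
  proof (cases "x i j \<le> 0")
    case True
    then have "w i j * x i j \<le> 0"
      using w[OF that] by (simp add: mult_nonneg_nonpos)
    then show ?thesis
      using exp_gt_zero[of "x i j"] by linarith
  next
    case False
    then have "w i j * x i j \<le> x i j"
      using w[OF that] by (simp add: mult_left_le_one_le)
    then show ?thesis
      using exp_ge_add_one_self[of "x i j"] by linarith
  qed
  have wu: "(\<Sum>i<n. \<Sum>j<n. w i j * u i) = (\<Sum>i<n. r i * u i)"
  proof -
    have "(\<Sum>j<n. w i j * u i) = r i * u i * (\<Sum>j<n. c j)" for i
      unfolding sum_distrib_left by (simp add: w_def mult_ac)
    then show ?thesis by (simp add: c_sum)
  qed
  have wv: "(\<Sum>i<n. \<Sum>j<n. w i j * v j) = (\<Sum>j<n. c j * v j)"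
  proof -
    have "(\<Sum>i<n. w i j * v j) = c j * v j * (\<Sum>i<n. r i)" for j
      unfolding sum_distrib_left by (simp add: w_def mult_ac)
    then show ?thesis by (subst sum.swap) (simp add: r_sum)
  qed
  have "(\<Sum>i<n. \<Sum>j<n. w i j * x i j) =
      (\<Sum>i<n. r i * u i) + (\<Sum>j<n. c j * v j) - (\<Sum>i<n. \<Sum>j<n. w i j * a i j)"
    unfolding wu[symmetric] wv[symmetric]
    by (simp add: x_def algebra_simps sum.distrib sum_subtractf)
  then have "pot u v = (\<Sum>i<n. \<Sum>j<n. exp (x i j) - w i j * x i j) - (\<Sum>i<n. \<Sum>j<n. w i j * a i j)"
    by (simp add: pot_def rsum_def kern_def x_def sum_subtractf)
  moreover have "(\<Sum>i<n. \<Sum>j<n. w i j * a i j) \<le> M"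
  proof -
    have "(\<Sum>i<n. \<Sum>j<n. w i j * a i j) \<le> (\<Sum>i<n. \<Sum>j<n. w i j * M)"
      using w(1) a_le by (intro sum_mono mult_left_mono) (auto simp: less_imp_le)
    also have "\<dots> = M"
      by (simp add: w_sum flip: sum_distrib_right)
    finally show ?thesis .
  qed
  moreover have "exp (x i j) - w i j * x i j \<le> (\<Sum>j<n. exp (x i j) - w i j * x i j)"
    using ij term_nonneg by (intro member_le_sum[of j "{..<n}" "\<lambda>j. exp (x i j) - w i j * x i j"]) auto
  moreover have "(\<Sum>j<n. exp (x i j) - w i j * x i j) \<le> (\<Sum>i<n. \<Sum>j<n. exp (x i j) - w i j * x i j)"
    using ij term_nonneg
    by (intro member_le_sum[of i "{..<n}" "\<lambda>i. \<Sum>j<n. exp (x i j) - w i j * x i j"] sum_nonneg) auto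
  ultimately have le: "exp (x i j) - w i j * x i j \<le> Q + M"
    using assms(2) by linarith
  have "\<bar>x i j\<bar> * w i j \<le> Q + M"
  proof (cases "x i j \<le> 0")
    case True
    then show ?thesis
      using le exp_gt_zero[of "x i j"] by (simp add: mult.commute del: exp_gt_zero)
  next
    case False
    then have "w i j * x i j \<le> x i j"
      using w[OF ij] by (simp add: mult_left_le_one_le)
    \<comment> \<open>Together with the square below this yields \<open>x \<le> exp x - x\<close>,
      and the right side is at most \<open>exp x - w x\<close>.\<close>
    moreover have "1 + x i j + (x i j)\<^sup>2 / 2 \<le> exp (x i j)"
      using False exp_lower_Taylor_quadratic[of "x i j"] by simp
    moreover have "0 \<le> (x i j - 1)\<^sup>2"
      by simp
    ultimately have "x i j \<le> Q + M"
      using le by (simp add: power2_eq_square algebra_simps)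
    then show ?thesis
      using \<open>w i j * x i j \<le> x i j\<close> False by (simp only: mult.commute abs_of_pos not_le)
  qed
  then show ?thesis
    using w(1)[OF ij] by (simp add: x_def w_def field_simps)
qed

text \<open>The flat direction comes from \<open>r\<close> and \<open>c\<close> having equal mass.
  It is why coercivity only controls the sums \<open>u i + v j\<close>, and it leaves one
  normalisation free.\<close>

lemma pot_shift: "pot (\<lambda>i. u i + s) (\<lambda>j. v j - s) = pot u v"
proof -
  have "kern (\<lambda>i. u i + s) (\<lambda>j. v j - s) = kern u v"
    by (simp add: fun_eq_iff kern_def)
  moreover have "(\<Sum>i<n. r i * (u i + s)) = (\<Sum>i<n. r i * u i) + s"
    by (simp add: distrib_left sum.distrib r_sum flip: sum_distrib_right)
  moreover have "(\<Sum>j<n. c j * (v j - s)) = (\<Sum>j<n. c j * v j) - s"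
    by (simp add: right_diff_distrib sum_subtractf c_sum flip: sum_distrib_right)
  ultimately show ?thesis
    by (simp add: pot_def rsum_def)
qed

lemma pot_cong:
  assumes "\<And>i. i < n \<Longrightarrow> u i = u' i" and "\<And>j. j < n \<Longrightarrow> v j = v' j"
  shows "pot u v = pot u' v'"
  using assms by (simp add: pot_def rsum_def kern_def)

lemma continuous_on_pot: "continuous_on S (\<lambda>p. pot (fst p) (snd p))"
proof -
  have f: "continuous_on S (\<lambda>p. fst p i)" for i :: nat and S :: "((nat \<Rightarrow> real) \<times> (nat \<Rightarrow> real)) set"
    by (rule continuous_on_product_then_coordinatewise) (intro continuous_intros)
  have s: "continuous_on S (\<lambda>p. snd p i)" for i :: nat and S :: "((nat \<Rightarrow> real) \<times> (nat \<Rightarrow> real)) set"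
    by (rule continuous_on_product_then_coordinatewise) (intro continuous_intros)
  show ?thesis
    unfolding pot_def rsum_def kern_def by (intro continuous_intros f s)
qed

text \<open>Direct method: a competitor not above the value \<open>Q\<close> at the origin is
  shifted to \<open>v 0 = 0\<close> and cut off to 0 from \<open>n\<close> on, which
  \<open>pot\<close> does not notice. Coercivity then places it in one fixed compact box.
  Competitors above \<open>Q\<close> lose against the origin, which lies in that box.\<close>

lemma pot_minimiser_exists: "\<exists>u v. \<forall>u' v'. pot u v \<le> pot u' v'"
proof -
  define Q where "Q = pot (\<lambda>_. 0) (\<lambda>_. 0)"
  have Q: "0 \<le> Q"
    unfolding Q_def pot_def using rsum_pos by (simp add: sum_nonneg less_imp_le)
  have M: "0 \<le> M"
    using a_nonneg[of 0 0] a_le[of 0 0] n_pos by linarith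
  define L where "L = (\<Sum>i<n. \<Sum>j<n. (Q + M) / (r i * c j))"
  have t: "0 \<le> (Q + M) / (r i * c j)" if "i < n" "j < n" for i j
    using Q M r_pos[OF that(1)] c_pos[OF that(2)] by simp
  have L: "(Q + M) / (r i * c j) \<le> L" if "i < n" "j < n" for i j
  proof -
    have "(Q + M) / (r i * c j) \<le> (\<Sum>j<n. (Q + M) / (r i * c j))"
      using that t by (intro member_le_sum[of j "{..<n}" "\<lambda>j. (Q + M) / (r i * c j)"]) auto
    also have "\<dots> \<le> L"
      unfolding L_def using that t
      by (intro member_le_sum[of i "{..<n}" "\<lambda>i. \<Sum>j<n. (Q + M) / (r i * c j)"] sum_nonneg) auto
    finally show ?thesis .
  qed
  \<comment> \<open>The factor 2 is for \<open>v j - v 0\<close>, the difference of the two bounded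
    sums \<open>u 0 + v j\<close> and \<open>u 0 + v 0\<close>.\<close>
  define W where "W = 2 * (L + M)"
  have L0: "0 \<le> L"
    unfolding L_def using t by (intro sum_nonneg) auto
  have W: "0 \<le> W" "L + M \<le> W"
    using L0 M by (auto simp: W_def)
  define box where "box = (PiE UNIV (\<lambda>_::nat. {- W..W})) \<times> (PiE UNIV (\<lambda>_::nat. {- W..W}))"
  have "compact box"
    unfolding box_def by (intro compact_Times compact_PiE_UNIV) auto
  moreover have zero: "(\<lambda>_. 0, \<lambda>_. 0) \<in> box"
    using W by (auto simp: box_def)
  ultimately obtain p where p: "p \<in> box" "\<And>q. q \<in> box \<Longrightarrow> pot (fst p) (snd p) \<le> pot (fst q) (snd q)"
    using continuous_attains_inf[OF _ _ continuous_on_pot, of box] by blast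
  have pQ: "pot (fst p) (snd p) \<le> Q"
    using p(2)[OF zero] by (simp add: Q_def)
  have "pot (fst p) (snd p) \<le> pot u v" for u v
  proof (cases "pot u v \<le> Q")
    case True
    have b: "\<bar>u i + v j\<bar> \<le> L + M" if "i < n" "j < n" for i j
      using kern_exponent_bounded[OF Q True that] L[OF that] a_nonneg[OF that] a_le[OF that] by linarith
    define u' where "u' i = (if i < n then u i + v 0 else 0)" for i
    define v' where "v' j = (if j < n then v j - v 0 else 0)" for j
    have "\<bar>u' i\<bar> \<le> W" for i
      using b[of i 0] n_pos W by (auto simp: u'_def)
    moreover have "\<bar>v' j\<bar> \<le> W" for j
    proof (cases "j < n")
      case True
      then show ?thesis
        using b[of 0 j] b[of 0 0] n_pos unfolding v'_def W_def by simp
    qed (use W in \<open>simp add: v'_def\<close>)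
    ultimately have "(u', v') \<in> box"
      by (auto simp: box_def abs_le_iff minus_le_iff)
    then have "pot (fst p) (snd p) \<le> pot u' v'"
      using p(2) by fastforce
    also have "pot u' v' = pot (\<lambda>i. u i + v 0) (\<lambda>j. v j - v 0)"
      by (rule pot_cong) (auto simp: u'_def v'_def)
    also have "\<dots> = pot u v"
      by (rule pot_shift)
    finally show ?thesis .
  qed (use pQ in simp)
  then show ?thesis
    by blast
qed

text \<open>Optimality conditions without derivatives: if a marginal of a minimiser were wrong,
  updating that coordinate would lower \<open>pot\<close> by a positive \<open>rho\<close>.\<close>

lemma scaling_exists:
  "\<exists>u v. (\<forall>i<n. rsum u v i = r i) \<and> (\<forall>j<n. csum u v j = c j)"
proof -
  obtain u v where min: "\<And>u' v'. pot u v \<le> pot u' v'"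
    using pot_minimiser_exists by blast
  have "rsum u v i = r i" if "i < n" for i
  proof (rule ccontr)
    assume "rsum u v i \<noteq> r i"
    then have "0 < rho (r i) (rsum u v i)"
      using r_pos[OF that] rsum_pos by (intro rho_pos) auto
    moreover have "row_update i u v (u(i := u i + ln (r i) - ln (rsum u v i))) v"
      using that by (auto simp: row_update_def)
    ultimately show False
      using min[of "u(i := u i + ln (r i) - ln (rsum u v i))" v] pot_row_update by fastforce
  qed
  moreover have "csum u v j = c j" if "j < n" for j
  proof (rule ccontr)
    assume "csum u v j \<noteq> c j"
    then have "0 < rho (c j) (csum u v j)"
      using c_pos[OF that] csum_pos by (intro rho_pos) auto
    moreover have "col_update j u v u (v(j := v j + ln (c j) - ln (csum u v j)))"
      using that by (auto simp: col_update_def)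
    ultimately show False
      using min[of u "v(j := v j + ln (c j) - ln (csum u v j))"] pot_col_update by fastforce
  qed
  ultimately show ?thesis
    by blast
qed

section \<open>Size of an optimal scaling\<close>

lemma rsum_bounds:
  assumes "i < n"
  shows "rsum u v i \<le> exp (u i) * (\<Sum>j<n. exp (v j))"
    and "exp (u i) * (\<Sum>j<n. exp (v j)) \<le> exp M * rsum u v i"
proof -
  have "kern u v i j \<le> exp (u i) * exp (v j)" if "j < n" for j
    using a_nonneg[OF assms that] by (simp add: kern_def flip: exp_add)
  then show "rsum u v i \<le> exp (u i) * (\<Sum>j<n. exp (v j))"
    unfolding rsum_def sum_distrib_left by (intro sum_mono) auto
  have "exp (u i) * exp (v j) \<le> exp M * kern u v i j" if "j < n" for j
    using a_le[OF assms that] by (simp add: kern_def flip: exp_add)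
  then show "exp (u i) * (\<Sum>j<n. exp (v j)) \<le> exp M * rsum u v i"
    unfolding rsum_def sum_distrib_left by (intro sum_mono) auto
qed

text \<open>The free shift is spent on \<open>\<Sum> exp (v j) = 1\<close>. As the kernel lies
  between \<open>exp (- M)\<close> and 1 times the rank-one matrix of the potentials,
  \<open>exp (u i)\<close> is then between \<open>r i\<close> and \<open>exp M * r i\<close>.
  Summing over \<open>i\<close> controls the mass of \<open>exp u\<close>, and the column equations
  control \<open>v\<close> in the same way.\<close>

lemma bounded_scaling_exists:
  assumes m: "0 < m" "\<And>i. i < n \<Longrightarrow> m \<le> r i" "\<And>j. j < n \<Longrightarrow> m \<le> c j"
  shows "\<exists>u v. (\<forall>i<n. rsum u v i = r i) \<and> (\<forall>j<n. csum u v j = c j) \<and>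
    (\<forall>i<n. \<bar>u i\<bar> \<le> M - ln m) \<and> (\<forall>j<n. \<bar>v j\<bar> \<le> M - ln m)"
proof -
  obtain u0 v0 where s0: "\<And>i. i < n \<Longrightarrow> rsum u0 v0 i = r i" "\<And>j. j < n \<Longrightarrow> csum u0 v0 j = c j"
    using scaling_exists by blast
  define s where "s = ln (\<Sum>j<n. exp (v0 j))"
  define u v where "u = (\<lambda>i. u0 i + s)" and "v = (\<lambda>j. v0 j - s)"
  have "kern u v = kern u0 v0"
    by (simp add: fun_eq_iff kern_def u_def v_def)
  then have sc: "\<And>i. i < n \<Longrightarrow> rsum u v i = r i" "\<And>j. j < n \<Longrightarrow> csum u v j = c j"
    using s0 by (auto simp: rsum_def csum_def)
  have V0: "0 < (\<Sum>j<n. exp (v0 j))"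
    using n_pos by (intro sum_pos) auto
  have V: "(\<Sum>j<n. exp (v j)) = 1"
    using V0 by (simp add: v_def s_def exp_diff flip: sum_divide_distrib)
  have r1: "r i \<le> 1" if "i < n" for i
    using member_le_sum[of i "{..<n}" r] that r_pos r_sum by (auto simp: less_imp_le)
  have c1: "c j \<le> 1" if "j < n" for j
    using member_le_sum[of j "{..<n}" c] that c_pos c_sum by (auto simp: less_imp_le)
  have u: "r i \<le> exp (u i)" "exp (u i) \<le> exp M * r i" if "i < n" for i
    using rsum_bounds[OF that, of u v] sc(1)[OF that] V by auto
  define U where "U = (\<Sum>i<n. exp (u i))"
  have U: "1 \<le> U" "U \<le> exp M"
  proof -
    have "(\<Sum>i<n. r i) \<le> U"
      unfolding U_def using u by (intro sum_mono) auto
    then show "1 \<le> U" by (simp add: r_sum)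
    have "U \<le> (\<Sum>i<n. exp M * r i)"
      unfolding U_def using u by (intro sum_mono) auto
    also have "\<dots> = exp M"
      by (simp add: r_sum flip: sum_distrib_left)
    finally show "U \<le> exp M" .
  qed
  interpret T: gibbs_scaling n "\<lambda>i j. a j i" M c r
    by (rule transposed)
  have v: "c j \<le> exp (v j) * U" "exp (v j) * U \<le> exp M * c j" if "j < n" for j
    using T.rsum_bounds[OF that, of v u] sc(2)[OF that] by (auto simp: U_def transposed_simps)
  have M: "0 \<le> M"
    using a_nonneg[of 0 0] a_le[of 0 0] n_pos by linarith
  have m1: "ln m \<le> 0"
    using m(1) m(2)[of 0] r1[of 0] n_pos by simp
  have ub: "\<bar>u i\<bar> \<le> M - ln m" if "i < n" for i
  proof -
    have "m \<le> exp (u i)"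
      using u(1)[OF that] m(2)[OF that] by linarith
    then have "ln m \<le> u i"
      using m(1) by (metis exp_le_cancel_iff exp_ln)
    moreover have "exp (u i) \<le> exp M"
      using u(2)[OF that] r1[OF that] by (meson exp_ge_zero mult_right_le_one_le order_trans r_pos that less_imp_le)
    ultimately show ?thesis
      using M m1 by (auto simp: abs_le_iff)
  qed
  have vb: "\<bar>v j\<bar> \<le> M - ln m" if "j < n" for j
  proof -
    have "m \<le> exp (v j) * exp M"
      using v(1)[OF that] m(3)[OF that] mult_left_mono[OF U(2), of "exp (v j)"]
      by (auto intro: order_trans)
    then have lower: "ln m \<le> v j + M"
      using m(1) by (simp add: ln_ge_iff flip: exp_add)
        (metis exp_le_cancel_iff exp_ln)
    have "exp (v j) * 1 \<le> exp (v j) * U"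
      using U(1) by (intro mult_left_mono) auto
    also have "\<dots> \<le> exp M * c j"
      by (rule v(2)[OF that])
    also have "\<dots> \<le> exp M * 1"
      using c1[OF that] by (intro mult_left_mono) auto
    finally have "v j \<le> M"
      by simp
    then show ?thesis
      using m1 lower by (auto simp: abs_le_iff)
  qed
  show ?thesis
    using sc ub vb by blast
qed

text \<open>The updated coordinate is \<open>ln (r i)\<close> minus a log-sum-exp of
  \<open>v\<close>. This map is nonexpansive in the sup norm and takes \<open>vs\<close> to
  \<open>us i\<close>, so the new coordinate inherits the bound that holds for
  \<open>v\<close>.\<close>

lemma row_update_contracts:
  assumes "row_update I u v u' v'"
    and opt: "\<And>i. i < n \<Longrightarrow> rsum us vs i = r i"
    and u: "\<And>i. i < n \<Longrightarrow> \<bar>u i - us i\<bar> \<le> R" and v: "\<And>j. j < n \<Longrightarrow> \<bar>v j - vs j\<bar> \<le> R"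
    and i: "i < n"
  shows "\<bar>u' i - us i\<bar> \<le> R" and "\<bar>v' i - vs i\<bar> \<le> R"
proof -
  show "\<bar>v' i - vs i\<bar> \<le> R"
    using assms by (auto simp: row_update_def)
  show "\<bar>u' i - us i\<bar> \<le> R"
  proof (cases "i = I")
    case True
    have eq: "u' i - us i = ln (r i) - (ln (rsum u v i) - u i + us i)"
      using assms(1) i True by (auto simp: row_update_def)
    have "rsum u v i \<le> exp (u i - us i + R) * r i"
    proof -
      have "kern u v i j \<le> exp (u i - us i + R) * kern us vs i j" if "j < n" for j
        using v[OF that] by (simp add: kern_def flip: exp_add)
      then show ?thesis
        unfolding opt[OF i, symmetric] rsum_def sum_distrib_left by (intro sum_mono) auto
    qed
    then have "ln (rsum u v i) \<le> u i - us i + R + ln (r i)"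
      using rsum_pos[of u v i] r_pos[OF i] by (metis exp_add exp_le_cancel_iff exp_ln)
    moreover have "exp (u i - us i - R) * r i \<le> rsum u v i"
    proof -
      have "exp (u i - us i - R) * kern us vs i j \<le> kern u v i j" if "j < n" for j
        using v[OF that] by (simp add: kern_def flip: exp_add)
      then show ?thesis
        unfolding opt[OF i, symmetric] rsum_def sum_distrib_left by (intro sum_mono) auto
    qed
    then have "u i - us i - R + ln (r i) \<le> ln (rsum u v i)"
      using rsum_pos[of u v i] r_pos[OF i] by (metis exp_add exp_le_cancel_iff exp_ln)
    ultimately show ?thesis
      unfolding eq by linarith
  next
    case False
    then show ?thesis
      using assms by (auto simp: row_update_def)
  qed
qed

lemma col_update_contracts:
  assumes "col_update J u v u' v'"
    and "\<And>j. j < n \<Longrightarrow> csum us vs j = c j"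
    and "\<And>i. i < n \<Longrightarrow> \<bar>u i - us i\<bar> \<le> R" and "\<And>j. j < n \<Longrightarrow> \<bar>v j - vs j\<bar> \<le> R"
    and "i < n"
  shows "\<bar>u' i - us i\<bar> \<le> R" and "\<bar>v' i - vs i\<bar> \<le> R"
proof -
  interpret T: gibbs_scaling n "\<lambda>i j. a j i" M c r
    by (rule transposed)
  have T: "T.row_update J v u v' u'"
    using assms(1) by (simp add: transposed_col_update)
  have o: "T.rsum vs us j = c j" if "j < n" for j
    using assms(2)[OF that] by (simp add: transposed_simps)
  show "\<bar>u' i - us i\<bar> \<le> R" "\<bar>v' i - vs i\<bar> \<le> R"
    using T.row_update_contracts[OF T o assms(4,3,5)] by auto
qed

section \<open>Decrease of the potential in a greedy step\<close>

lemma err_le_total_rho: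
  assumes "0 \<le> \<theta>" and "\<theta> \<le> 1 / 2"
  shows "\<theta> * err u v \<le> total_rho u v + 4 * \<theta>\<^sup>2"
proof -
  have "\<theta> * (\<Sum>i<n. \<bar>rsum u v i - r i\<bar>) \<le> (\<Sum>i<n. rho (r i) (rsum u v i) + 2 * \<theta>\<^sup>2 * r i)"
    unfolding sum_distrib_left
  proof (rule sum_mono)
    fix i assume "i \<in> {..<n}"
    then show "\<theta> * \<bar>rsum u v i - r i\<bar> \<le> rho (r i) (rsum u v i) + 2 * \<theta>\<^sup>2 * r i"
      using abs_diff_le_rho[OF r_pos rsum_pos assms, of i u v i] by (simp add: abs_minus_commute)
  qed
  moreover have "\<theta> * (\<Sum>i<n. \<bar>csum u v i - c i\<bar>) \<le> (\<Sum>i<n. rho (c i) (csum u v i) + 2 * \<theta>\<^sup>2 * c i)"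
    unfolding sum_distrib_left
  proof (rule sum_mono)
    fix i assume "i \<in> {..<n}"
    then show "\<theta> * \<bar>csum u v i - c i\<bar> \<le> rho (c i) (csum u v i) + 2 * \<theta>\<^sup>2 * c i"
      using abs_diff_le_rho[OF c_pos csum_pos assms, of i u v i] by (simp add: abs_minus_commute)
  qed
  ultimately show ?thesis
    by (simp add: err_def total_rho_def sum.distrib r_sum c_sum distrib_left flip: sum_distrib_left)
qed

lemma err_nonneg: "0 \<le> err u v"
  by (simp add: err_def sum_nonneg)

lemma total_rho_ge_square: "(min (err u v) 2)\<^sup>2 / 16 \<le> total_rho u v"
proof -
  \<comment> \<open>For error \<open>e\<close>, the expression
    \<open>\<theta> * e - 4 * \<theta>\<^sup>2\<close> is largest at \<open>e / 8\<close>. The cap 2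
    corresponds to slope 1/4, the fixed slope of the linear estimate that takes over there.\<close>
  define \<theta> where "\<theta> = min (err u v) 2 / 8"
  have \<theta>: "0 \<le> \<theta>" "\<theta> \<le> 1 / 2" "8 * \<theta> \<le> err u v"
    using err_nonneg by (auto simp: \<theta>_def)
  have "\<theta> * (8 * \<theta>) \<le> \<theta> * err u v"
    using \<theta> by (intro mult_left_mono) auto
  then have "4 * \<theta>\<^sup>2 \<le> total_rho u v"
    using err_le_total_rho[OF \<theta>(1,2), of u v] by (simp add: power2_eq_square)
  moreover have "4 * \<theta>\<^sup>2 = (min (err u v) 2)\<^sup>2 / 16"
    by (simp add: \<theta>_def power2_eq_square)
  ultimately show ?thesis
    by simp
qed

lemma total_rho_ge_linear: "2 \<le> err u v \<Longrightarrow> err u v / 8 \<le> total_rho u v"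
  using err_le_total_rho[of "1 / 4" u v] by (simp add: power2_eq_square)

text \<open>The decrease is the largest of the \<open>2 * n\<close> summands of
  \<open>total_rho\<close>, hence at least their average.\<close>

lemma pot_greedy_step:
  assumes "greedy_step u v u' v'"
  shows "pot u' v' \<le> pot u v - total_rho u v / (2 * real n)"
proof -
  obtain I J where IJ: "\<forall>i<n. rho (r i) (rsum u v i) \<le> rho (r I) (rsum u v I)"
     "\<forall>j<n. rho (c j) (csum u v j) \<le> rho (c J) (csum u v J)"
     "if rho (r I) (rsum u v I) > rho (c J) (csum u v J)
      then row_update I u v u' v' else col_update J u v u' v'"
    using assms by (auto simp: greedy_step_def)
  define d where "d = max (rho (r I) (rsum u v I)) (rho (c J) (csum u v J))"
  have "(\<Sum>i<n. rho (r i) (rsum u v i)) \<le> (\<Sum>i<n. d)" "(\<Sum>j<n. rho (c j) (csum u v j)) \<le> (\<Sum>j<n. d)"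
    using IJ(1,2) by (intro sum_mono; force simp: d_def)+
  then have "total_rho u v \<le> d * (2 * real n)"
    by (simp add: total_rho_def algebra_simps)
  then have "total_rho u v / (2 * real n) \<le> d"
    using n_pos by (simp add: divide_le_eq)
  moreover have "pot u' v' = pot u v - d"
    using IJ(3) pot_row_update pot_col_update by (auto simp: d_def max_def split: if_splits)
  ultimately show ?thesis
    by simp
qed

text \<open>The ranking function of the gap \<open>D\<close> to the optimal potential: its logarithmic part pays for
  the steps at which the mass of the iterate is still large, its other part for the steps with
  quadratic decrease.\<close>

definition rank_fun :: "real \<Rightarrow> real \<Rightarrow> real \<Rightarrow> real" where
  "rank_fun R \<tau> D = 32 * real n * ln (8 * R + D) - 512 * real n * R / (\<tau> + D / (4 * R))"

text \<open>If \<open>D\<close> drops to \<open>D'\<close>, the logarithm drops by at least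
  \<open>(D - D') / (8 * R + D)\<close> and the reciprocal of
  \<open>x = \<tau> + D / (4 * R)\<close> grows by at least \<open>(x - x') / x\<^sup>2\<close>.
  Each regime makes one of these gains worth a full unit and the other nonnegative.\<close>

lemma rank_fun_decreases:
  assumes R: "1 \<le> R" and \<tau>: "0 < \<tau>" "\<tau> \<le> 2" "\<tau> \<le> err u v"
    and D: "0 \<le> D'" "D' \<le> D - total_rho u v / (2 * real n)"
      "D \<le> R * err u v" "D \<le> err u v / 2 + 2 * R"
  shows "rank_fun R \<tau> D' + 1 \<le> rank_fun R \<tau> D"
proof -
  have n: "0 < real n"
    using n_pos by simp
  have tr: "0 \<le> total_rho u v"
    using total_rho_ge_square[of u v] by (smt (verit) divide_nonneg_pos zero_le_power2)
  then have le: "D' \<le> D"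
    using D(2) n by (smt (verit) divide_nonneg_pos)
  have D0: "0 \<le> D"
    using le D(1) by simp
  define x where "x = \<tau> + D / (4 * R)"
  define x' where "x' = \<tau> + D' / (4 * R)"
  have x': "0 < x'" "x' \<le> x"
    using R \<tau> D(1) le by (auto simp: x_def x'_def add_pos_nonneg divide_right_mono)
  have second: "(x - x') / (x * x) \<le> 1 / x' - 1 / x"
  proof -
    have "1 / x' - 1 / x = (x - x') / (x * x')"
      using x' by (simp add: field_simps)
    moreover have "(x - x') / (x * x) \<le> (x - x') / (x * x')"
      using x' by (intro divide_left_mono mult_left_mono) auto
    ultimately show ?thesis by simp
  qed
  have first: "(D - D') / (8 * R + D) \<le> ln (8 * R + D) - ln (8 * R + D')"
  proof -
    have "ln ((8 * R + D') / (8 * R + D)) \<le> (8 * R + D') / (8 * R + D) - 1"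
      using R D0 D(1) by (intro ln_le_minus_one) auto
    then show ?thesis
      using R D0 D(1) by (simp add: ln_div field_simps)
  qed
  have split: "rank_fun R \<tau> D - rank_fun R \<tau> D' =
      32 * real n * (ln (8 * R + D) - ln (8 * R + D')) + 512 * real n * R * (1 / x' - 1 / x)"
    by (simp add: rank_fun_def x_def x'_def algebra_simps)
  show ?thesis
  proof (cases "D \<le> 8 * R")
    case True
    define e where "e = min (err u v) 2"
    \<comment> \<open>Both summands of \<open>x\<close> are dominated by the truncated error: the
      threshold \<open>8 * R\<close> makes \<open>D / (4 * R)\<close> at most 2, and
      \<open>D \<le> R * err\<close> makes it at most \<open>err\<close>.\<close>
    have "D / (4 * R) \<le> e"
      using True D(3) D0 R err_nonneg[of u v] by (auto simp: e_def divide_le_eq algebra_simps)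
    moreover have "\<tau> \<le> e"
      using \<tau> by (simp add: e_def)
    ultimately have "x \<le> 2 * e"
      by (simp add: x_def)
    then have "x\<^sup>2 \<le> (2 * e)\<^sup>2"
      using x' by (intro power_mono) auto
    then have "x\<^sup>2 / 64 \<le> total_rho u v"
      using total_rho_ge_square[of u v] by (simp add: e_def power_mult_distrib)
    then have "x\<^sup>2 / 64 / (2 * real n) \<le> D - D'"
      using D(2) n divide_right_mono[of "x\<^sup>2 / 64" "total_rho u v" "2 * real n"] by linarith
    then have "x\<^sup>2 / 64 / (2 * real n) / (4 * R) \<le> (D - D') / (4 * R)"
      using R by (intro divide_right_mono) auto
    also have "(D - D') / (4 * R) = x - x'"
      by (simp add: x_def x'_def diff_divide_distrib)
    finally have "x\<^sup>2 / 64 / (2 * real n) / (4 * R) / (x * x) \<le> (x - x') / (x * x)"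
      using x' by (intro divide_right_mono) auto
    \<comment> \<open>The weight 512 is 64 from \<open>x\<^sup>2 / 64 \<le> total_rho\<close>, times
      2 from averaging over \<open>2 * n\<close> coordinates, times 4 from the scale
      \<open>4 * R\<close> in \<open>x\<close>.\<close>
    then have "1 / (512 * real n * R) \<le> 1 / x' - 1 / x"
      using second x' by (simp add: power2_eq_square mult_ac)
    then have "1 \<le> 512 * real n * R * (1 / x' - 1 / x)"
      using n R by (simp add: divide_le_eq mult_ac)
    moreover have "0 \<le> ln (8 * R + D) - ln (8 * R + D')"
      using R le D(1) by simp
    then have "0 \<le> 32 * real n * (ln (8 * R + D) - ln (8 * R + D'))"
      by simp
    ultimately show ?thesis
      using split by linarith
  next
    case False
    \<comment> \<open>As \<open>2 * R < D / 4\<close>, the mass bound gives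
      \<open>3 * D / 4 \<le> err / 2\<close>. The linear decrease is therefore a fixed fraction of
      \<open>D\<close>, with no factor \<open>R\<close>.\<close>
    then have "D \<le> err u v" "2 \<le> err u v"
      using D(4) R by linarith+
    then have "D / 8 \<le> total_rho u v"
      using total_rho_ge_linear[of u v] by linarith
    then have "D / 8 / (2 * real n) \<le> D - D'"
      using D(2) n divide_right_mono[of "D / 8" "total_rho u v" "2 * real n"] by linarith
    \<comment> \<open>The weight 32 is 8 * 2 * 2, the last factor because
      \<open>8 * R + D \<le> 2 * D\<close> in this regime.\<close>
    moreover have "1 / (32 * real n) \<le> D / 8 / (2 * real n) / (8 * R + D)"
    proof -
      have "1 / (32 * real n) = (8 * R + D) / 16 / (2 * real n) / (8 * R + D)"
        using False R n by simp
      also have "\<dots> \<le> D / 8 / (2 * real n) / (8 * R + D)"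
        using False R n by (intro divide_right_mono) auto
      finally show ?thesis .
    qed
    ultimately have "1 / (32 * real n) \<le> (D - D') / (8 * R + D)"
      using False R D0 by (smt (verit) divide_right_mono)
    then have "1 \<le> 32 * real n * (ln (8 * R + D) - ln (8 * R + D'))"
      using first n by (smt (verit) divide_le_eq mult.commute)
    moreover have "0 \<le> 512 * real n * R * (1 / x' - 1 / x)"
      using x' R n by (intro mult_nonneg_nonneg) (auto simp: field_simps)
    ultimately show ?thesis
      using split by linarith
  qed
qed

theorem greedy_iteration_bound:
  fixes us vs :: "nat \<Rightarrow> nat \<Rightarrow> real"
  assumes n2: "2 \<le> n"
    and m: "0 < m" "\<And>i. i < n \<Longrightarrow> m \<le> r i" "\<And>j. j < n \<Longrightarrow> m \<le> c j"
    and R: "1 \<le> R" "M - ln m \<le> R"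
    and \<tau>: "0 < \<tau>" "\<tau> \<le> 2"
    and start: "\<And>i. i < n \<Longrightarrow> us 0 i = 0" "\<And>j. j < n \<Longrightarrow> vs 0 j = 0"
    and step: "\<And>t. t < T \<Longrightarrow> greedy_step (us t) (vs t) (us (Suc t)) (vs (Suc t))"
    and large: "\<And>t. t < T \<Longrightarrow> \<tau> \<le> err (us t) (vs t)"
  shows "real T \<le> 64 * real n * ln (real n) + 512 * real n * R / \<tau>"
proof -
  obtain u v where opt: "\<And>i. i < n \<Longrightarrow> rsum u v i = r i" "\<And>j. j < n \<Longrightarrow> csum u v j = c j"
    and bd: "\<And>i. i < n \<Longrightarrow> \<bar>u i\<bar> \<le> M - ln m" "\<And>j. j < n \<Longrightarrow> \<bar>v j\<bar> \<le> M - ln m"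
    using bounded_scaling_exists[OF m] by blast
  have near: "(\<forall>i<n. \<bar>us t i - u i\<bar> \<le> R) \<and> (\<forall>j<n. \<bar>vs t j - v j\<bar> \<le> R)" if "t \<le> T" for t
    using that
  proof (induction t)
    case 0
    then show ?case
      using bd R start by (auto intro: order_trans)
  next
    case (Suc t)
    then have IH: "\<And>i. i < n \<Longrightarrow> \<bar>us t i - u i\<bar> \<le> R" "\<And>j. j < n \<Longrightarrow> \<bar>vs t j - v j\<bar> \<le> R"
      and st: "greedy_step (us t) (vs t) (us (Suc t)) (vs (Suc t))"
      using step by auto
    then obtain k where "row_update k (us t) (vs t) (us (Suc t)) (vs (Suc t)) \<or>
        col_update k (us t) (vs t) (us (Suc t)) (vs (Suc t))"
      by (auto simp: greedy_step_def split: if_splits)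
    then show ?case
      using row_update_contracts[OF _ opt(1) IH] col_update_contracts[OF _ opt(2) IH] by blast
  qed
  define D where "D t = pot (us t) (vs t) - pot u v" for t
  have D_nonneg: "0 \<le> D t" for t
    using pot_convex[of u v "us t" "vs t"] opt by (simp add: D_def)
  have bilinear: "x * y \<le> R * \<bar>y\<bar>" if "\<bar>x\<bar> \<le> R" for x y :: real
    using mult_right_mono[OF that abs_ge_zero[of y]] abs_ge_self[of "x * y"] by (simp add: abs_mult)
  have D_le: "D t \<le> R * err (us t) (vs t)" if "t \<le> T" for t
  proof -
    have "(\<Sum>i<n. (us t i - u i) * (rsum (us t) (vs t) i - r i)) \<le>
        (\<Sum>i<n. R * \<bar>rsum (us t) (vs t) i - r i\<bar>)"
      using near[OF that] by (intro sum_mono bilinear) auto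
    moreover have "(\<Sum>j<n. (vs t j - v j) * (csum (us t) (vs t) j - c j)) \<le>
        (\<Sum>j<n. R * \<bar>csum (us t) (vs t) j - c j\<bar>)"
      using near[OF that] by (intro sum_mono bilinear) auto
    ultimately show ?thesis
      using pot_convex[of "us t" "vs t" u v]
      by (simp add: D_def err_def distrib_left sum_distrib_left)
  qed
  \<comment> \<open>Obtained from the potentials directly: the optimum has mass 1, and the linear
    terms differ by at most \<open>R\<close> for each marginal since both marginals have mass
    1.\<close>
  have D_mass: "D t \<le> (\<Sum>i<n. rsum (us t) (vs t) i) - 1 + 2 * R" if "t \<le> T" for t
  proof -
    have "(\<Sum>i<n. r i * (u i - us t i)) \<le> (\<Sum>i<n. r i * R)"
      using near[OF that] r_pos by (intro sum_mono mult_left_mono) (auto simp: abs_le_iff less_imp_le)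
    moreover have "(\<Sum>j<n. c j * (v j - vs t j)) \<le> (\<Sum>j<n. c j * R)"
      using near[OF that] c_pos by (intro sum_mono mult_left_mono) (auto simp: abs_le_iff less_imp_le)
    ultimately show ?thesis
      using opt by (simp add: D_def pot_def r_sum c_sum right_diff_distrib sum_subtractf
          flip: sum_distrib_right)
  qed
  \<comment> \<open>Excess mass appears once in the row error and once in the column error, hence
    the factor 1/2.\<close>
  have mass: "(\<Sum>i<n. rsum (us t) (vs t) i) - 1 \<le> err (us t) (vs t) / 2" for t
  proof -
    have "(\<Sum>i<n. rsum (us t) (vs t) i - r i) \<le> (\<Sum>i<n. \<bar>rsum (us t) (vs t) i - r i\<bar>)"
      "(\<Sum>j<n. csum (us t) (vs t) j - c j) \<le> (\<Sum>j<n. \<bar>csum (us t) (vs t) j - c j\<bar>)"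
      by (intro sum_mono; simp)+
    then show ?thesis
      by (simp add: err_def sum_subtractf r_sum c_sum sum_rsum_eq_sum_csum)
  qed
  have rank: "real t + rank_fun R \<tau> (D t) \<le> rank_fun R \<tau> (D 0)" if "t \<le> T" for t
    using that
  proof (induction t)
    case (Suc t)
    then have t: "t < T" by simp
    have "rank_fun R \<tau> (D (Suc t)) + 1 \<le> rank_fun R \<tau> (D t)"
    proof (rule rank_fun_decreases[OF R(1) \<tau> large[OF t] D_nonneg])
      show "D (Suc t) \<le> D t - total_rho (us t) (vs t) / (2 * real n)"
        using pot_greedy_step[OF step[OF t]] by (simp add: D_def)
    qed (use D_le[of t] D_mass[of t] mass[of t] t in auto)
    then show ?case
      using Suc by simp
  qed simp
  have n: "0 < real n" "4 \<le> (real n)\<^sup>2"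
    using n2 power_mono[of 2 "real n" 2] by auto
  have "rsum (us 0) (vs 0) i \<le> real n" if "i < n" for i
  proof -
    have "rsum (us 0) (vs 0) i \<le> (\<Sum>j<n. 1)"
      unfolding rsum_def kern_def using start a_nonneg that by (intro sum_mono) auto
    then show ?thesis by simp
  qed
  then have "(\<Sum>i<n. rsum (us 0) (vs 0) i) \<le> (\<Sum>i<n. real n)"
    by (intro sum_mono) auto
  then have "D 0 \<le> (real n)\<^sup>2 + 2 * R"
    using D_mass[of 0] by (simp add: power2_eq_square)
  moreover have "1 * (real n)\<^sup>2 \<le> R * (real n)\<^sup>2" "R * 4 \<le> R * (real n)\<^sup>2"
    using R n by (intro mult_right_mono mult_left_mono; simp)+
  \<comment> \<open>The factor \<open>8 * R\<close> cancels against the lower bound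
    \<open>8 * R\<close> of \<open>8 * R + D T\<close>. This is the purpose of the offset in the
    logarithm of \<open>rank_fun\<close>: only \<open>2 * ln n\<close> remains, without
    \<open>ln R\<close>.\<close>
  ultimately have "8 * R + D 0 \<le> 8 * R * (real n)\<^sup>2"
    using R by linarith
  then have "ln (8 * R + D 0) \<le> ln (8 * R * (real n)\<^sup>2)"
    using R n D_nonneg[of 0] by (subst ln_le_cancel_iff) auto
  also have "\<dots> = ln (8 * R) + 2 * ln (real n)"
    using R n by (simp add: ln_mult ln_realpow)
  finally have "32 * real n * ln (8 * R + D 0) \<le> 32 * real n * (ln (8 * R) + 2 * ln (real n))"
    by (intro mult_left_mono) auto
  moreover have "0 \<le> 512 * real n * R / (\<tau> + D 0 / (4 * R))"
    using \<tau> R D_nonneg[of 0] by simp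
  moreover have "32 * real n * ln (8 * R) \<le> 32 * real n * ln (8 * R + D T)"
    using R D_nonneg[of T] by (intro mult_left_mono) auto
  moreover have "512 * real n * R / (\<tau> + D T / (4 * R)) \<le> 512 * real n * R / \<tau>"
    using \<tau> R D_nonneg[of T] by (intro divide_left_mono mult_pos_pos add_pos_nonneg) auto
  ultimately show ?thesis
    using rank[of T] by (simp add: rank_fun_def algebra_simps)
qed

end

section \<open>Rounding\<close>

text \<open>The subtracted term is the sum of the positive parts of \<open>y - x\<close>, written as
  \<open>(\<bar>d\<bar> + d) / 2\<close>. It expresses the mass that survives a truncation by l1
  distances and total masses.\<close>

lemma sum_min_eq:
  fixes x y :: "'a \<Rightarrow> real"
  shows "(\<Sum>i\<in>A. min (x i) (y i)) = (\<Sum>i\<in>A. y i) - ((\<Sum>i\<in>A. \<bar>y i - x i\<bar>) + (\<Sum>i\<in>A. y i) - (\<Sum>i\<in>A. x i)) / 2"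
proof -
  have "min (x i) (y i) = y i - (\<bar>y i - x i\<bar> + y i - x i) / 2" for i
    by (auto simp: min_def field_simps)
  then show ?thesis
    by (simp add: sum_subtractf sum.distrib flip: sum_divide_distrib)
qed

lemma row_sums_dim [simp]: "dim_vec (row_sums F) = dim_row F"
  by (simp add: row_sums_def)

lemma col_sums_dim [simp]: "dim_vec (col_sums F) = dim_col F"
  by (simp add: col_sums_def)

lemma row_sums_index: "i < dim_row F \<Longrightarrow> row_sums F $ i = (\<Sum>j<dim_col F. F $$ (i, j))"
  by (simp add: row_sums_def ones_def scalar_prod_def atLeast0LessThan)

lemma col_sums_index: "j < dim_col F \<Longrightarrow> col_sums F $ j = (\<Sum>i<dim_row F. F $$ (i, j))"
  by (simp add: col_sums_def ones_def scalar_prod_def atLeast0LessThan)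

lemma marginal_error_eq:
  assumes "F \<in> carrier_mat n n" and "r \<in> carrier_vec n" and "c \<in> carrier_vec n"
  shows "marginal_error F r c =
    (\<Sum>i<n. \<bar>(\<Sum>j<n. F $$ (i, j)) - r $ i\<bar>) + (\<Sum>j<n. \<bar>(\<Sum>i<n. F $$ (i, j)) - c $ j\<bar>)"
  using assms by (simp add: marginal_error_def norm1_def row_sums_index col_sums_index)

text \<open>An entrywise form that replaces the products with diagonal matrices and tests a norm
  instead of a vector. It serves both the mass estimate and the comparison with the program.\<close>

lemma round_to_eq:
  assumes F: "F \<in> carrier_mat n n" and r: "r \<in> carrier_vec n" and c: "c \<in> carrier_vec n"
  defines "F' \<equiv> mat n n (\<lambda>(i, j). min (r $ i / row_sums F $ i) 1 * F $$ (i, j))"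
  defines "F'' \<equiv> mat n n (\<lambda>(i, j). F' $$ (i, j) * min (c $ j / col_sums F' $ j) 1)"
  shows "round_to r c F =
    (if norm1 (r - row_sums F'') = 0 then F''
     else mat n n (\<lambda>(i, j). F'' $$ (i, j) +
       (r $ i - row_sums F'' $ i) * (c $ j - col_sums F'' $ j) / norm1 (r - row_sums F'')))"
proof -
  have 1: "mat_diag n (\<lambda>i. min (r $ i / row_sums F $ i) 1) * F = F'"
    unfolding F'_def by (rule mat_diag_mult_left[OF F])
  have F'c: "F' \<in> carrier_mat n n"
    by (simp add: F'_def)
  have 2: "F' * mat_diag n (\<lambda>j. min (c $ j / col_sums F' $ j) 1) = F''"
    unfolding F''_def by (rule mat_diag_mult_right[OF F'c])
  have F''c: "dim_row F'' = n" "dim_col F'' = n"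
    by (simp_all add: F''_def)
  have "norm1 (r - row_sums F'') = 0 \<longleftrightarrow> (\<forall>i<n. (r - row_sums F'') $ i = 0)"
    using F''c by (auto simp: norm1_def sum_nonneg_eq_0_iff)
  also have "\<dots> \<longleftrightarrow> r - row_sums F'' = 0\<^sub>v n"
    using F''c r by (auto simp: vec_eq_iff)
  finally have 3: "r - row_sums F'' = 0\<^sub>v n \<longleftrightarrow> norm1 (r - row_sums F'') = 0"
    by simp
  have n: "dim_vec r = n"
    using r by simp
  show ?thesis
    unfolding round_to_def Let_def n 1 2 3
    using F''c c by (auto intro!: eq_matI)
qed

text \<open>Only equality of the masses is required, not mass 1, because an optimal plan is also
  rounded to the marginals of a Greenkhorn iterate, whose mass is arbitrary.\<close>

locale rounding =
  fixes n :: nat and r c :: "real vec" and F :: "real mat"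
  assumes r: "r \<in> carrier_vec n" "\<And>i. i < n \<Longrightarrow> 0 \<le> r $ i"
    and c: "c \<in> carrier_vec n" "\<And>j. j < n \<Longrightarrow> 0 \<le> c $ j"
    and mass: "(\<Sum>i<n. r $ i) = (\<Sum>j<n. c $ j)"
    and F: "F \<in> nonneg_mats n"
begin

text \<open>The rounded matrix is a submatrix in the entrywise order plus a rank-one filling of mass
  \<open>N\<close>. Row scaling removes exactly the row excess and column scaling at most the
  original column excess. Since both marginals have the same mass, what is then missing is at most
  half of the l1 error.\<close>

lemma rounded_entries:
  obtains f er ec N where
    "\<And>i j. i < n \<Longrightarrow> j < n \<Longrightarrow> round_to r c F $$ (i, j) = f i j + er i * ec j / N"
    "\<And>i j. i < n \<Longrightarrow> j < n \<Longrightarrow> 0 \<le> f i j \<and> f i j \<le> F $$ (i, j)"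
    "\<And>i. i < n \<Longrightarrow> 0 \<le> er i \<and> er i = r $ i - (\<Sum>j<n. f i j)"
    "\<And>j. j < n \<Longrightarrow> 0 \<le> ec j \<and> ec j = c $ j - (\<Sum>i<n. f i j)"
    "N = (\<Sum>i<n. er i)" "N = (\<Sum>j<n. ec j)" "N \<le> marginal_error F r c / 2"
proof -
  have Fc: "F \<in> carrier_mat n n" and F0: "\<And>i j. i < n \<Longrightarrow> j < n \<Longrightarrow> 0 \<le> F $$ (i, j)"
    using F by (auto simp: nonneg_mats_def)
  define p where "p i = (\<Sum>j<n. F $$ (i, j))" for i
  define q where "q j = (\<Sum>i<n. F $$ (i, j))" for j
  define x where "x i = min (r $ i / p i) 1" for i
  define q' where "q' j = (\<Sum>i<n. x i * F $$ (i, j))" for j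
  define y where "y j = min (c $ j / q' j) 1" for j
  define f where "f i j = x i * F $$ (i, j) * y j" for i j
  define er where "er i = r $ i - (\<Sum>j<n. f i j)" for i
  define ec where "ec j = c $ j - (\<Sum>i<n. f i j)" for j
  define N where "N = (\<Sum>i<n. er i)"
  have p: "0 \<le> p i" if "i < n" for i
    unfolding p_def using F0 that by (intro sum_nonneg) auto
  have x: "0 \<le> x i" "x i \<le> 1" if "i < n" for i
    using p[OF that] r(2)[OF that] by (auto simp: x_def)
  have q': "0 \<le> q' j" "q' j \<le> q j" if "j < n" for j
  proof -
    show "0 \<le> q' j"
      unfolding q'_def using F0 x that by (intro sum_nonneg) auto
    show "q' j \<le> q j"
      unfolding q'_def q_def using F0 x that by (intro sum_mono) (auto intro: mult_left_le_one_le)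
  qed
  have y: "0 \<le> y j" "y j \<le> 1" if "j < n" for j
    using q'[OF that] c(2)[OF that] by (auto simp: y_def)
  \<comment> \<open>For an empty row the quotient \<open>r $ i / p i\<close> is 0 by convention, and
    both sides vanish. The same applies to columns.\<close>
  have xp: "x i * p i = min (r $ i) (p i)" if "i < n" for i
    using p[OF that] r(2)[OF that] by (auto simp: x_def min_def field_simps)
  have yq: "q' j * y j = min (c $ j) (q' j)" if "j < n" for j
    using q'(1)[OF that] c(2)[OF that] by (auto simp: y_def min_def field_simps)
  have xF: "0 \<le> x i * F $$ (i, j)" if "i < n" "j < n" for i j
    using x[OF that(1)] F0[OF that] by simp
  have f: "0 \<le> f i j" "f i j \<le> x i * F $$ (i, j)" "f i j \<le> F $$ (i, j)" if "i < n" "j < n" for i j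
  proof -
    show "0 \<le> f i j"
      unfolding f_def using xF[OF that] y[OF that(2)] by simp
    show 1: "f i j \<le> x i * F $$ (i, j)"
      unfolding f_def using xF[OF that] y[OF that(2)] by (intro mult_right_le_one_le) auto
    have "x i * F $$ (i, j) \<le> F $$ (i, j)"
      using x[OF that(1)] F0[OF that] by (intro mult_left_le_one_le) auto
    then show "f i j \<le> F $$ (i, j)"
      using 1 by linarith
  qed
  have fcol: "(\<Sum>i<n. f i j) = q' j * y j" for j
    by (simp add: f_def q'_def sum_distrib_right)
  have er: "0 \<le> er i" if "i < n" for i
  proof -
    have "(\<Sum>j<n. f i j) \<le> (\<Sum>j<n. x i * F $$ (i, j))"
      using f that by (intro sum_mono) auto
    also have "\<dots> = min (r $ i) (p i)"
      using xp[OF that] by (simp add: p_def sum_distrib_left)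
    finally show ?thesis
      by (simp add: er_def)
  qed
  have ec: "0 \<le> ec j" if "j < n" for j
    using yq[OF that] by (simp add: ec_def fcol)
  have Nc: "N = (\<Sum>j<n. ec j)"
    unfolding N_def er_def ec_def sum_subtractf mass by (simp add: sum.swap[of f])
  have Nle: "N \<le> marginal_error F r c / 2"
  proof -
    \<comment> \<open>Lowering a column sum from \<open>q j\<close> to \<open>q' j\<close> lowers
      its truncation by at most the same amount; the total lowering is the row excess.\<close>
    have "(\<Sum>j<n. min (c $ j) (q j)) - (\<Sum>j<n. q j - q' j) \<le> (\<Sum>j<n. min (c $ j) (q' j))"
      unfolding sum_subtractf[symmetric]
    proof (rule sum_mono)
      fix j assume "j \<in> {..<n}"
      then show "min (c $ j) (q j) - (q j - q' j) \<le> min (c $ j) (q' j)"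
        using q'[of j] by (auto simp: min_def)
    qed
    moreover have "(\<Sum>j<n. min (c $ j) (q' j)) = (\<Sum>i<n. \<Sum>j<n. f i j)"
      using yq by (subst sum.swap) (simp add: fcol)
    moreover have "(\<Sum>j<n. q' j) = (\<Sum>i<n. min (r $ i) (p i))"
      unfolding q'_def by (subst sum.swap) (simp add: xp flip: p_def sum_distrib_left)
    moreover have "(\<Sum>j<n. q j) = (\<Sum>i<n. p i)"
      unfolding q_def p_def by (rule sum.swap)
    moreover have "marginal_error F r c = (\<Sum>i<n. \<bar>p i - r $ i\<bar>) + (\<Sum>j<n. \<bar>q j - c $ j\<bar>)"
      unfolding marginal_error_eq[OF Fc r(1) c(1)] p_def q_def ..
    moreover have "N = (\<Sum>i<n. r $ i) - (\<Sum>i<n. \<Sum>j<n. f i j)"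
      by (simp add: N_def er_def sum_subtractf)
    ultimately show ?thesis
      using mass sum_min_eq[of "\<lambda>j. c $ j" q "{..<n}"] sum_min_eq[of "\<lambda>i. r $ i" p "{..<n}"]
      by (simp add: sum_subtractf field_simps)
  qed
  define F' where "F' = mat n n (\<lambda>(i, j). min (r $ i / row_sums F $ i) 1 * F $$ (i, j))"
  define F'' where "F'' = mat n n (\<lambda>(i, j). F' $$ (i, j) * min (c $ j / col_sums F' $ j) 1)"
  have F': "F' = mat n n (\<lambda>(i, j). x i * F $$ (i, j))"
    unfolding F'_def using Fc by (intro eq_matI) (auto simp: x_def p_def row_sums_index)
  have F'': "F'' = mat n n (\<lambda>(i, j). f i j)"
    unfolding F''_def by (intro eq_matI) (auto simp: F' f_def y_def q'_def col_sums_index)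
  have sums: "row_sums F'' $ i = (\<Sum>j<n. f i j)" "col_sums F'' $ i = (\<Sum>j<n. f j i)" if "i < n" for i
    using that by (simp_all add: F'' row_sums_index col_sums_index)
  have norm: "norm1 (r - row_sums F'') = N"
    unfolding N_def norm1_def using er by (simp add: F'' er_def row_sums_index)
  have zero: "er i = 0" if "N = 0" "i < n" for i
    using that er sum_nonneg_eq_0_iff[of "{..<n}" er] by (simp add: N_def)
  have entries: "round_to r c F $$ (i, j) = f i j + er i * ec j / N" if "i < n" "j < n" for i j
    unfolding round_to_eq[OF Fc r(1) c(1), folded F'_def, folded F''_def] norm
    using that zero[OF _ that(1)] by (simp add: sums er_def ec_def) (simp add: F'')
  show ?thesis
    by (rule that[of f er ec N]) (use entries f er ec Nc Nle in \<open>auto simp: er_def ec_def N_def\<close>)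
qed

lemma round_to_carrier: "round_to r c F \<in> carrier_mat n n"
  using F round_to_eq[OF _ r(1) c(1), of F] by (auto simp: nonneg_mats_def)

text \<open>The rank-one term has row sums \<open>er\<close> and column sums \<open>ec\<close>
  because \<open>N\<close> is the total of either vector. If \<open>N = 0\<close>, both are zero
  vectors by nonnegativity.\<close>

lemma round_to_feasible:
  shows "round_to r c F \<in> nonneg_mats n"
    and "row_sums (round_to r c F) = r" and "col_sums (round_to r c F) = c"
proof -
  obtain f er ec N where e: "\<And>i j. i < n \<Longrightarrow> j < n \<Longrightarrow> round_to r c F $$ (i, j) = f i j + er i * ec j / N"
    and f: "\<And>i j. i < n \<Longrightarrow> j < n \<Longrightarrow> 0 \<le> f i j \<and> f i j \<le> F $$ (i, j)"
    and er: "\<And>i. i < n \<Longrightarrow> 0 \<le> er i \<and> er i = r $ i - (\<Sum>j<n. f i j)"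
    and ec: "\<And>j. j < n \<Longrightarrow> 0 \<le> ec j \<and> ec j = c $ j - (\<Sum>i<n. f i j)"
    and N: "N = (\<Sum>i<n. er i)" "N = (\<Sum>j<n. ec j)"
    by (rule rounded_entries) blast
  have N0: "0 \<le> N"
    unfolding N(1) using er by (metis lessThan_iff sum_nonneg)
  have dim: "dim_row (round_to r c F) = n" "dim_col (round_to r c F) = n"
    using round_to_carrier by auto
  have "0 \<le> er i * ec j / N" if "i < n" "j < n" for i j
    using er[OF that(1)] ec[OF that(2)] N0 by (metis divide_nonneg_nonneg mult_nonneg_nonneg)
  then show "round_to r c F \<in> nonneg_mats n"
    using round_to_carrier e f by (auto simp: nonneg_mats_def)
  have z: "er i = 0" "ec i = 0" if "N = 0" "i < n" for i
    using that er ec N by (metis finite_lessThan lessThan_iff sum_nonneg_eq_0_iff)+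
  have r_rows: "(\<Sum>j<n. f i j + er i * ec j / N) = r $ i" if "i < n" for i
  proof -
    have "(\<Sum>j<n. f i j + er i * ec j / N) = (\<Sum>j<n. f i j) + er i * (\<Sum>j<n. ec j) / N"
      by (simp add: sum.distrib sum_distrib_left sum_divide_distrib)
    then show ?thesis
      using er[OF that] z[OF _ that] N(2) by (cases "N = 0") auto
  qed
  then show "row_sums (round_to r c F) = r"
    using r(1) by (intro eq_vecI) (auto simp: row_sums_index dim e)
  have "(\<Sum>i<n. f i j + er i * ec j / N) = c $ j" if "j < n" for j
  proof -
    have "(\<Sum>i<n. f i j + er i * ec j / N) = (\<Sum>i<n. f i j) + (\<Sum>i<n. er i) * ec j / N"
      by (simp add: sum.distrib sum_distrib_right sum_divide_distrib)
    then show ?thesis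
      using ec[OF that] z[OF _ that] N(1) by (cases "N = 0") auto
  qed
  then show "col_sums (round_to r c F) = c"
    using c(1) by (intro eq_vecI) (auto simp: col_sums_index dim e)
qed

text \<open>Only the entries that grow during rounding matter for a nonnegative cost, and the mass that
  is added is at most half of the marginal error.\<close>

lemma round_to_cost:
  assumes C: "C \<in> nonneg_mats n" and M: "\<And>i j. i < n \<Longrightarrow> j < n \<Longrightarrow> C $$ (i, j) \<le> M"
  shows "mat_inner C (round_to r c F) \<le> mat_inner C F + M * marginal_error F r c / 2"
proof -
  obtain f er ec N where e: "\<And>i j. i < n \<Longrightarrow> j < n \<Longrightarrow> round_to r c F $$ (i, j) = f i j + er i * ec j / N"
    and f: "\<And>i j. i < n \<Longrightarrow> j < n \<Longrightarrow> 0 \<le> f i j \<and> f i j \<le> F $$ (i, j)"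
    and er: "\<And>i. i < n \<Longrightarrow> 0 \<le> er i"
    and ec: "\<And>j. j < n \<Longrightarrow> 0 \<le> ec j"
    and N: "N = (\<Sum>i<n. er i)" "N = (\<Sum>j<n. ec j)" and Nle: "N \<le> marginal_error F r c / 2"
    by (rule rounded_entries) blast
  have Cd: "dim_row C = n" "dim_col C = n" and C0: "\<And>i j. i < n \<Longrightarrow> j < n \<Longrightarrow> 0 \<le> C $$ (i, j)"
    using C by (auto simp: nonneg_mats_def)
  have N0: "0 \<le> N"
    unfolding N(1) using er by (intro sum_nonneg) auto
  have "mat_inner C (round_to r c F) =
      (\<Sum>i<n. \<Sum>j<n. C $$ (i, j) * f i j) + (\<Sum>i<n. \<Sum>j<n. C $$ (i, j) * (er i * ec j / N))"
    by (simp add: mat_inner_def Cd e distrib_left sum.distrib)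
  also have "(\<Sum>i<n. \<Sum>j<n. C $$ (i, j) * f i j) \<le> mat_inner C F"
    unfolding mat_inner_def Cd using f C0 by (intro sum_mono mult_left_mono) auto
  also have "(\<Sum>i<n. \<Sum>j<n. C $$ (i, j) * (er i * ec j / N)) \<le> (\<Sum>i<n. \<Sum>j<n. M * (er i * ec j / N))"
    using er ec N0 M by (intro sum_mono mult_right_mono) auto
  also have "\<dots> = M * ((\<Sum>i<n. er i) * (\<Sum>j<n. ec j) / N)"
    by (simp add: sum_product flip: sum_distrib_left sum_divide_distrib)
  also have "\<dots> = M * N"
    unfolding N[symmetric] by simp
  finally have le: "mat_inner C (round_to r c F) \<le> mat_inner C F + M * N"
    by simp
  show ?thesis
  \<comment> \<open>For \<open>n = 0\<close> nothing forces \<open>M\<close> to be nonnegative, but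
    then the marginal error is 0.\<close>
  proof (cases "n = 0")
    case True
    then have "marginal_error F r c = 0"
      using F r(1) c(1) by (subst marginal_error_eq[of _ n]) (auto simp: nonneg_mats_def)
    then show ?thesis
      using True by (simp add: mat_inner_def Cd)
  next
    case False
    then have "0 \<le> M"
      using C0[of 0 0] M[of 0 0] by linarith
    then have "M * N \<le> M * (marginal_error F r c / 2)"
      using Nle by (rule mult_left_mono[rotated])
    then show ?thesis
      using le by simp
  qed
qed

end

section \<open>Quality of the output\<close>

lemma gibbs_inequality:
  fixes x y :: real
  assumes "0 \<le> x" and "0 < y"
  shows "x - y \<le> x * ln x - x * ln y"
proof (cases "x = 0")
  case False
  then have "ln (y / x) \<le> y / x - 1"
    using assms by (intro ln_le_minus_one) auto
  then have "x * ln (y / x) \<le> x * (y / x - 1)"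
    using assms by (intro mult_left_mono) auto
  then show ?thesis
    using assms False by (simp add: ln_div algebra_simps)
qed (use assms in simp)

lemma scaled_kernel_carrier [simp]:
  "C \<in> carrier_mat n n \<Longrightarrow> scaled_kernel C \<eta> u v \<in> carrier_mat n n"
  by (auto simp: scaled_kernel_def)

lemma scaled_kernel_dims [simp]:
  "dim_row (scaled_kernel C \<eta> u v) = dim_row C" "dim_col (scaled_kernel C \<eta> u v) = dim_col C"
  by (simp_all add: scaled_kernel_def)

lemma scaled_kernel_index:
  "C \<in> carrier_mat n n \<Longrightarrow> i < n \<Longrightarrow> j < n \<Longrightarrow>
    scaled_kernel C \<eta> u v $$ (i, j) = exp (u $ i + v $ j - C $$ (i, j) / \<eta>)"
  by (auto simp: scaled_kernel_def)

text \<open>A scaled kernel minimises the entropically regularised cost among the plans with the same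
  marginals, and the entropies of two plans of mass \<open>S\<close> differ by at most \<open>S * ln (n\<^sup>2)\<close>.\<close>

lemma scaled_kernel_cost:
  fixes C Y :: "real mat" and u v :: "real vec"
  assumes n: "0 < n" and C: "C \<in> carrier_mat n n" and Y: "Y \<in> nonneg_mats n" and \<eta>: "0 < \<eta>"
  defines "F \<equiv> scaled_kernel C \<eta> u v"
  assumes rows: "\<And>i. i < n \<Longrightarrow> (\<Sum>j<n. Y $$ (i, j)) = (\<Sum>j<n. F $$ (i, j))"
    and cols: "\<And>j. j < n \<Longrightarrow> (\<Sum>i<n. Y $$ (i, j)) = (\<Sum>i<n. F $$ (i, j))"
  shows "mat_inner C F \<le> mat_inner C Y + \<eta> * (\<Sum>i<n. \<Sum>j<n. F $$ (i, j)) * (2 * ln (real n))"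
proof -
  define f where "f i j = F $$ (i, j)" for i j
  define y where "y i j = Y $$ (i, j)" for i j
  define S where "S = (\<Sum>i<n. \<Sum>j<n. f i j)"
  have f: "f i j = exp (u $ i + v $ j - C $$ (i, j) / \<eta>)" if "i < n" "j < n" for i j
    unfolding f_def F_def by (rule scaled_kernel_index[OF C that])
  have f_pos: "0 < f i j" if "i < n" "j < n" for i j
    by (simp add: f that)
  have y0: "0 \<le> y i j" if "i < n" "j < n" for i j
    using Y that by (simp add: nonneg_mats_def y_def)
  have S_pos: "0 < S"
    unfolding S_def using n f_pos by (intro sum_pos) auto
  have Sy: "(\<Sum>i<n. \<Sum>j<n. y i j) = S"
    using rows by (simp add: S_def f_def y_def)
  \<comment> \<open>The potentials see a plan only through its marginals, so they cancel when
    \<open>Y\<close> is compared with \<open>F\<close>.\<close>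
  have uv: "(\<Sum>i<n. \<Sum>j<n. y i j * (u $ i + v $ j)) = (\<Sum>i<n. \<Sum>j<n. f i j * (u $ i + v $ j))"
  proof -
    have split: "(\<Sum>i<n. \<Sum>j<n. z i j * (u $ i + v $ j)) =
        (\<Sum>i<n. (\<Sum>j<n. z i j) * u $ i) + (\<Sum>j<n. (\<Sum>i<n. z i j) * v $ j)" for z :: "nat \<Rightarrow> nat \<Rightarrow> real"
      by (simp add: distrib_left sum.distrib sum_distrib_right sum.swap[of "\<lambda>i j. z i j * v $ j"])
    show ?thesis
      unfolding split using rows cols by (simp add: f_def y_def)
  qed
  have inner: "(\<Sum>i<n. \<Sum>j<n. z i j * ln (f i j)) =
      (\<Sum>i<n. \<Sum>j<n. z i j * (u $ i + v $ j)) - (\<Sum>i<n. \<Sum>j<n. C $$ (i, j) * z i j) / \<eta>"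
    for z :: "nat \<Rightarrow> nat \<Rightarrow> real"
    by (simp add: f right_diff_distrib sum_subtractf sum_divide_distrib mult.commute)
  \<comment> \<open>Nonnegativity of the divergence of \<open>Y\<close> from \<open>F\<close>; the
    linear terms cancel because the masses agree.\<close>
  have "(\<Sum>i<n. \<Sum>j<n. y i j - f i j) \<le> (\<Sum>i<n. \<Sum>j<n. y i j * ln (y i j) - y i j * ln (f i j))"
    using y0 f_pos by (intro sum_mono gibbs_inequality) auto
  then have 1: "(\<Sum>i<n. \<Sum>j<n. y i j * ln (f i j)) \<le> (\<Sum>i<n. \<Sum>j<n. y i j * ln (y i j))"
    by (simp add: sum_subtractf Sy S_def[symmetric])
  have "y i j * ln (y i j) \<le> y i j * ln S" if "i < n" "j < n" for i j
  proof (cases "y i j = 0")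
    case False
    have "y i j \<le> (\<Sum>j<n. y i j)"
      using that y0 by (intro member_le_sum[of j "{..<n}" "\<lambda>j. y i j"]) auto
    also have "\<dots> \<le> (\<Sum>i<n. \<Sum>j<n. y i j)"
      using that y0 by (intro member_le_sum[of i "{..<n}" "\<lambda>i. \<Sum>j<n. y i j"] sum_nonneg) auto
    finally have "y i j \<le> S"
      by (simp add: Sy)
    then show ?thesis
      using False y0[OF that] S_pos by (intro mult_left_mono) auto
  qed simp
  then have "(\<Sum>i<n. \<Sum>j<n. y i j * ln (y i j)) \<le> (\<Sum>i<n. \<Sum>j<n. y i j * ln S)"
    by (intro sum_mono) auto
  then have 2: "(\<Sum>i<n. \<Sum>j<n. y i j * ln (y i j)) \<le> S * ln S"
    by (simp add: Sy flip: sum_distrib_right)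
  \<comment> \<open>The comparison with the uniform matrix of mass \<open>S\<close> bounds the
    entropy of \<open>F\<close> and produces the \<open>2 * ln n\<close>.\<close>
  have "(\<Sum>i<n. \<Sum>j<n. f i j - S / (real n)\<^sup>2) \<le>
      (\<Sum>i<n. \<Sum>j<n. f i j * ln (f i j) - f i j * ln (S / (real n)\<^sup>2))"
    using f_pos S_pos n by (intro sum_mono gibbs_inequality) (auto simp: less_imp_le)
  moreover have "(\<Sum>i<n. \<Sum>j<n. f i j - S / (real n)\<^sup>2) = 0"
    using n by (simp add: sum_subtractf S_def[symmetric] power2_eq_square)
  ultimately have "S * ln (S / (real n)\<^sup>2) \<le> (\<Sum>i<n. \<Sum>j<n. f i j * ln (f i j))"
    by (simp add: sum_subtractf S_def flip: sum_distrib_right)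
  then have 3: "S * ln S - S * (2 * ln (real n)) \<le> (\<Sum>i<n. \<Sum>j<n. f i j * ln (f i j))"
    using n S_pos by (simp add: ln_div ln_realpow right_diff_distrib)
  have "mat_inner C F / \<eta> \<le> mat_inner C Y / \<eta> + S * (2 * ln (real n))"
    using 1 2 3 uv inner[of y] inner[of f] C by (simp add: mat_inner_def f_def y_def)
  then have "mat_inner C F / \<eta> * \<eta> \<le> (mat_inner C Y / \<eta> + S * (2 * ln (real n))) * \<eta>"
    using \<eta> by (intro mult_right_mono) auto
  then show ?thesis
    using \<eta> by (simp add: S_def f_def algebra_simps)
qed

lemma max_entry_ge:
  assumes "i < dim_row C" and "j < dim_col C"
  shows "C $$ (i, j) \<le> max_entry C"
proof -
  have "C $$ (i, j) \<in> elements_mat C"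
    using assms by (force simp: elements_mat_def)
  then show ?thesis
    unfolding max_entry_def by (intro Max_ge) (auto simp: elements_mat_def)
qed

section \<open>Smoothed marginals and the error budget\<close>

lemma ot_smooth_index:
  assumes "r \<in> prob_simplex n" and "i < n"
  shows "ot_smooth C \<epsilon> r $ i = (1 - ot_eps C \<epsilon> / 8) * r $ i + ot_eps C \<epsilon> / (8 * real n)"
  using assms by (auto simp: ot_smooth_def ones_def prob_simplex_def)

lemma sum_ot_smooth:
  assumes "r \<in> prob_simplex n" and "0 < n"
  shows "(\<Sum>i<n. ot_smooth C \<epsilon> r $ i) = 1"
proof -
  have "(\<Sum>i<n. ot_smooth C \<epsilon> r $ i) =
      (\<Sum>i<n. (1 - ot_eps C \<epsilon> / 8) * r $ i + ot_eps C \<epsilon> / (8 * real n))"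
    using assms by (intro sum.cong) (auto simp: ot_smooth_index)
  also have "\<dots> = (1 - ot_eps C \<epsilon> / 8) * (\<Sum>i<n. r $ i) + ot_eps C \<epsilon> / 8"
    using assms(2) by (simp add: sum.distrib flip: sum_distrib_left)
  finally show ?thesis
    using assms by (simp add: prob_simplex_def)
qed

lemma ot_smooth_dist:
  assumes r: "r \<in> prob_simplex n" and n: "0 < n" and e: "0 \<le> ot_eps C \<epsilon>"
  shows "(\<Sum>i<n. \<bar>ot_smooth C \<epsilon> r $ i - r $ i\<bar>) \<le> ot_eps C \<epsilon> / 4"
proof -
  define w where "w = ot_eps C \<epsilon> / 8"
  have "\<bar>ot_smooth C \<epsilon> r $ i - r $ i\<bar> \<le> w * (1 / real n) + w * r $ i" if "i < n" for i
  proof -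
    have "ot_smooth C \<epsilon> r $ i - r $ i = w * (1 / real n) - w * r $ i"
      by (simp add: ot_smooth_index[OF r that] w_def algebra_simps)
    moreover have "0 \<le> w * (1 / real n)" "0 \<le> w * r $ i"
      using r that e by (auto simp: w_def prob_simplex_def)
    ultimately show ?thesis
      by linarith
  qed
  then have "(\<Sum>i<n. \<bar>ot_smooth C \<epsilon> r $ i - r $ i\<bar>) \<le> (\<Sum>i<n. w * (1 / real n) + w * r $ i)"
    by (intro sum_mono) auto
  also have "\<dots> = 2 * w"
    using r n by (simp add: sum.distrib prob_simplex_def flip: sum_distrib_left)
  finally show ?thesis
    by (simp add: w_def)
qed

lemma transport_plans_iff:
  "X \<in> transport_plans n r c \<longleftrightarrow> X \<in> nonneg_mats n \<and> row_sums X = r \<and> col_sums X = c"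
  by (auto simp: transport_plans_def nonneg_mats_def row_sums_def col_sums_def)

theorem ot_outputs_correct:
  assumes n: "2 \<le> n" and C: "C \<in> nonneg_mats n" and M: "0 < max_entry C"
    and r: "r \<in> prob_simplex n" and c: "c \<in> prob_simplex n" and \<epsilon>: "0 < \<epsilon>"
    and X: "X \<in> ot_outputs C r c \<epsilon>"
  shows "X \<in> transport_plans n r c"
    and "X' \<in> transport_plans n r c \<Longrightarrow> mat_inner C X \<le> mat_inner C X' + \<epsilon>"
proof -
  let ?r = "ot_smooth C \<epsilon> r" and ?c = "ot_smooth C \<epsilon> c"
  obtain u v where X_eq: "X = round_to r c (scaled_kernel C (ot_eta C \<epsilon>) u v)"
    and err: "marginal_error (scaled_kernel C (ot_eta C \<epsilon>) u v) ?r ?c \<le> ot_eps C \<epsilon> / 2"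
    using X by (auto simp: ot_outputs_def greenkhorn_outputs_def)
  define F where "F = scaled_kernel C (ot_eta C \<epsilon>) u v"
  have Cc: "C \<in> carrier_mat n n" and C0: "\<And>i j. i < n \<Longrightarrow> j < n \<Longrightarrow> 0 \<le> C $$ (i, j)"
    using C by (auto simp: nonneg_mats_def)
  have CM: "C $$ (i, j) \<le> max_entry C" if "i < n" "j < n" for i j
    using max_entry_ge[of i C j] that Cc by auto
  have Fc: "F \<in> carrier_mat n n"
    using Cc by (simp add: F_def)
  have F_pos: "0 < F $$ (i, j)" if "i < n" "j < n" for i j
    by (simp add: F_def scaled_kernel_index[OF Cc that])
  have F: "F \<in> nonneg_mats n"
    using Fc F_pos by (auto simp: nonneg_mats_def less_imp_le)
  have rc: "r \<in> carrier_vec n" "c \<in> carrier_vec n" "\<And>i. i < n \<Longrightarrow> 0 \<le> r $ i" "\<And>i. i < n \<Longrightarrow> 0 \<le> c $ i"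
    "(\<Sum>i<n. r $ i) = 1" "(\<Sum>i<n. c $ i) = 1"
    using r c by (auto simp: prob_simplex_def)
  interpret A: rounding n r c F
    using rc F by unfold_locales auto
  show X_plan: "X \<in> transport_plans n r c"
    unfolding transport_plans_iff X_eq F_def[symmetric] using A.round_to_feasible by simp
  assume X': "X' \<in> transport_plans n r c"
  then have X'0: "X' \<in> nonneg_mats n" and X'c: "X' \<in> carrier_mat n n"
    and X'r: "\<And>i. i < n \<Longrightarrow> (\<Sum>j<n. X' $$ (i, j)) = r $ i"
    and X'col: "\<And>j. j < n \<Longrightarrow> (\<Sum>i<n. X' $$ (i, j)) = c $ j"
    by (auto simp: transport_plans_iff nonneg_mats_def row_sums_index col_sums_index)
  have mass1: "(\<Sum>i<n. \<Sum>j<n. Y $$ (i, j)) = 1" if "Y \<in> transport_plans n r c" for Y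
    using that rc by (auto simp: transport_plans_iff nonneg_mats_def row_sums_index)
  show "mat_inner C X \<le> mat_inner C X' + \<epsilon>"
  proof (cases "max_entry C \<le> \<epsilon>")
    case True
    have "mat_inner C X \<le> (\<Sum>i<n. \<Sum>j<n. max_entry C * X $$ (i, j))"
      using Cc X_plan CM by (auto simp: mat_inner_def transport_plans_def nonneg_mats_def
          intro!: sum_mono mult_right_mono)
    also have "\<dots> = max_entry C"
      by (simp add: mass1[OF X_plan] flip: sum_distrib_left)
    finally have "mat_inner C X \<le> \<epsilon>"
      using True by simp
    moreover have "0 \<le> mat_inner C X'"
      unfolding mat_inner_def using C0 X'0 Cc by (intro sum_nonneg) (auto simp: nonneg_mats_def)
    ultimately show ?thesis
      by simp
  next
    case False
    define e where "e = ot_eps C \<epsilon>"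
    have e: "0 < e" "e \<le> 1 / 8" "max_entry C * e = \<epsilon> / 8"
      using False M \<epsilon> by (auto simp: e_def ot_eps_def field_simps)
    define \<delta> where "\<delta> = marginal_error F r c"
    define p where "p i = (\<Sum>j<n. F $$ (i, j))" for i
    define q where "q j = (\<Sum>i<n. F $$ (i, j))" for j
    have err': "(\<Sum>i<n. \<bar>p i - ?r $ i\<bar>) + (\<Sum>j<n. \<bar>q j - ?c $ j\<bar>) \<le> e / 2"
      using err rc marginal_error_eq[OF Fc, of ?r ?c]
      by (simp add: F_def[symmetric] p_def q_def e_def ot_smooth_def ones_def)
    \<comment> \<open>The tolerance contributes \<open>e / 2\<close> and the smoothing of each
      marginal \<open>e / 4\<close>.\<close>
    have \<delta>: "\<delta> \<le> e"
    proof -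
      have "(\<Sum>i<n. \<bar>p i - r $ i\<bar>) \<le> (\<Sum>i<n. \<bar>p i - ?r $ i\<bar>) + (\<Sum>i<n. \<bar>?r $ i - r $ i\<bar>)"
        "(\<Sum>j<n. \<bar>q j - c $ j\<bar>) \<le> (\<Sum>j<n. \<bar>q j - ?c $ j\<bar>) + (\<Sum>j<n. \<bar>?c $ j - c $ j\<bar>)"
        unfolding sum.distrib[symmetric] by (intro sum_mono; linarith)+
      then show ?thesis
        using err' ot_smooth_dist[OF r, of C \<epsilon>] ot_smooth_dist[OF c, of C \<epsilon>] n e(1)
        unfolding \<delta>_def marginal_error_eq[OF Fc rc(1,2)] p_def[symmetric] q_def[symmetric] e_def
        by simp
    qed
    define S where "S = (\<Sum>i<n. p i)"
    have Sq: "S = (\<Sum>j<n. q j)"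
      unfolding S_def p_def q_def by (rule sum.swap)
    have S: "S \<le> 1 + e / 4"
    proof -
      have "(\<Sum>i<n. p i - ?r $ i) \<le> (\<Sum>i<n. \<bar>p i - ?r $ i\<bar>)"
        "(\<Sum>j<n. q j - ?c $ j) \<le> (\<Sum>j<n. \<bar>q j - ?c $ j\<bar>)"
        by (intro sum_mono; simp)+
      then show ?thesis
        using err' n by (simp add: sum_subtractf sum_ot_smooth[OF r] sum_ot_smooth[OF c]
            S_def[symmetric] Sq[symmetric])
    qed
    have pq: "row_sums F \<in> carrier_vec n" "col_sums F \<in> carrier_vec n"
      "\<And>i. i < n \<Longrightarrow> row_sums F $ i = p i" "\<And>i. i < n \<Longrightarrow> col_sums F $ i = q i"
      using Fc by (auto simp: p_def q_def row_sums_index col_sums_index intro!: carrier_vecI)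
    have pq0: "0 \<le> p i" "0 \<le> q i" if "i < n" for i
      unfolding p_def q_def using F_pos that by (auto intro!: sum_nonneg simp: less_imp_le)
    interpret B: rounding n "row_sums F" "col_sums F" X'
      using pq pq0 X'0 Sq by unfold_locales (auto simp: S_def)
    define Y where "Y = round_to (row_sums F) (col_sums F) X'"
    have Y: "Y \<in> nonneg_mats n" "row_sums Y = row_sums F" "col_sums Y = col_sums F"
      unfolding Y_def by (rule B.round_to_feasible)+
    have Yc: "dim_row Y = n" "dim_col Y = n"
      using Y(1) by (auto simp: nonneg_mats_def)
    have "marginal_error X' (row_sums F) (col_sums F) = \<delta>"
      unfolding \<delta>_def marginal_error_eq[OF Fc rc(1,2)] marginal_error_eq[OF X'c pq(1,2)]
      by (simp add: X'r X'col pq(3,4) p_def q_def abs_minus_commute)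
    then have 1: "mat_inner C Y \<le> mat_inner C X' + max_entry C * \<delta> / 2"
      unfolding Y_def using B.round_to_cost[OF C CM] by simp
    have 2: "mat_inner C X \<le> mat_inner C F + max_entry C * \<delta> / 2"
      unfolding \<delta>_def X_eq F_def[symmetric] by (rule A.round_to_cost[OF C CM])
    have l: "0 < ln (real n)"
      using n by simp
    \<comment> \<open>The definition of \<open>ot_eta\<close> makes the entropy gap
      \<open>2 * ln n\<close> cost \<epsilon> / 2 per unit of mass.\<close>
    have \<eta>: "0 < ot_eta C \<epsilon>" "ot_eta C \<epsilon> * S * (2 * ln (real n)) = S * \<epsilon> / 2"
      using \<epsilon> l Cc by (auto simp: ot_eta_def)
    have "mat_inner C F \<le> mat_inner C Y + ot_eta C \<epsilon> * S * (2 * ln (real n))"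
      unfolding S_def p_def F_def
    proof (rule scaled_kernel_cost[OF _ Cc Y(1) \<eta>(1)])
      show "(\<Sum>j<n. Y $$ (i, j)) = (\<Sum>j<n. scaled_kernel C (ot_eta C \<epsilon>) u v $$ (i, j))" if "i < n" for i
        using arg_cong[OF Y(2), of "\<lambda>x. x $ i"] that Fc Yc by (simp add: row_sums_index F_def[symmetric])
      show "(\<Sum>i<n. Y $$ (i, j)) = (\<Sum>i<n. scaled_kernel C (ot_eta C \<epsilon>) u v $$ (i, j))" if "j < n" for j
        using arg_cong[OF Y(3), of "\<lambda>x. x $ j"] that Fc Yc by (simp add: col_sums_index F_def[symmetric])
    qed (use n in simp)
    then have 3: "mat_inner C F \<le> mat_inner C Y + S * \<epsilon> / 2"
      unfolding \<eta>(2) .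
    have 4: "max_entry C * \<delta> \<le> \<epsilon> / 8"
      using mult_left_mono[OF \<delta>, of "max_entry C"] M e(3) by simp
    \<comment> \<open>The budget is \<epsilon> / 16 for each of the two roundings and 33/64
      \<epsilon> for the entropy, where 33/32 bounds \<open>1 + e / 4\<close>. The product is named
      so that the final step is linear.\<close>
    define s where "s = S * \<epsilon> / 2"
    have "S * \<epsilon> \<le> 33 / 32 * \<epsilon>"
      using S e \<epsilon> by (intro mult_right_mono) auto
    then have "s \<le> 33 / 64 * \<epsilon>"
      unfolding s_def by simp
    then show ?thesis
      using 1 2 3[folded s_def] 4 \<epsilon> by linarith
  qed
qed

section \<open>Number of iterations\<close>

lemma greenkhorn_iteration_dims:
  assumes "greenkhorn_iteration C \<eta> r c \<tau> s s'"
  shows "dim_vec (fst s') = dim_vec (fst s)" and "dim_vec (snd s') = dim_vec (snd s)"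
  using assms
  by (auto simp: greenkhorn_iteration_def greenkhorn_step_def Let_def split_beta split: if_splits)

lemma greenkhorn_reachable_dims:
  assumes "(greenkhorn_iteration C \<eta> r c \<tau> ^^ t) (greenkhorn_start C) s" and "C \<in> carrier_mat n n"
  shows "dim_vec (fst s) = n \<and> dim_vec (snd s) = n"
  using assms(1)
proof (induction t arbitrary: s)
  case 0
  then show ?case
    using assms(2) by (auto simp: greenkhorn_start_def)
next
  case (Suc t)
  then show ?case
    by (metis greenkhorn_iteration_dims relpowp_Suc_E)
qed

text \<open>The separate threshold \<sigma> is there because the ranking argument needs a threshold
  of at most 2 while the tolerance may be larger. Before stopping, every error exceeds \<tau> and
  hence is at least \<sigma>.\<close>

theorem greenkhorn_iterations_bound:
  assumes n: "2 \<le> n" and C: "C \<in> nonneg_mats n" and \<eta>: "0 < \<eta>"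
    and r: "r \<in> carrier_vec n" "positive_vec r" "(\<Sum>i<n. r $ i) = 1"
    and c: "c \<in> carrier_vec n" "positive_vec c" "(\<Sum>i<n. c $ i) = 1"
    and m: "0 < m" "\<And>i. i < n \<Longrightarrow> m \<le> r $ i" "\<And>i. i < n \<Longrightarrow> m \<le> c $ i"
    and R: "1 \<le> R" "max_entry C / \<eta> - ln m \<le> R"
    and \<sigma>: "0 < \<sigma>" "\<sigma> \<le> 2" "\<sigma> \<le> \<tau>"
    and chain: "(greenkhorn_iteration C \<eta> r c \<tau> ^^ T) (greenkhorn_start C) s"
  shows "real T \<le> 64 * real n * ln (real n) + 512 * real n * R / \<sigma>"
proof -
  have Cc: "C \<in> carrier_mat n n" and C0: "\<And>i j. i < n \<Longrightarrow> j < n \<Longrightarrow> 0 \<le> C $$ (i, j)"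
    using C by (auto simp: nonneg_mats_def)
  have CM: "C $$ (i, j) \<le> max_entry C" if "i < n" "j < n" for i j
    using max_entry_ge[of i C j] that Cc by auto
  interpret S: gibbs_scaling n "\<lambda>i j. C $$ (i, j) / \<eta>" "max_entry C / \<eta>" "\<lambda>i. r $ i" "\<lambda>j. c $ j"
    using C0 CM \<eta> r c by unfold_locales (auto simp: positive_vec_def divide_right_mono)
  have sums: "row_sums (scaled_kernel C \<eta> u v) $ i = S.rsum (\<lambda>i. u $ i) (\<lambda>j. v $ j) i"
      "col_sums (scaled_kernel C \<eta> u v) $ i = S.csum (\<lambda>i. u $ i) (\<lambda>j. v $ j) i" if "i < n" for u v i
    using that Cc
    by (auto simp: row_sums_index col_sums_index S.rsum_def S.csum_def S.kern_def scaled_kernel_index)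
  have err: "marginal_error (scaled_kernel C \<eta> u v) r c = S.err (\<lambda>i. u $ i) (\<lambda>j. v $ j)" for u v
    using Cc r c scaled_kernel_carrier[OF Cc, of \<eta> u v]
    by (simp add: marginal_error_def norm1_def S.err_def sums)
  have step: "S.greedy_step (\<lambda>i. u $ i) (\<lambda>j. v $ j) (\<lambda>i. u' $ i) (\<lambda>j. v' $ j)"
    if st: "greenkhorn_step C \<eta> r c (u, v) (u', v')" and dim: "dim_vec u = n" "dim_vec v = n" for u v u' v'
  proof -
    let ?p = "S.rsum (\<lambda>i. u $ i) (\<lambda>j. v $ j)" and ?q = "S.csum (\<lambda>i. u $ i) (\<lambda>j. v $ j)"
    obtain I J where IJ: "I < n" "J < n"
      "\<forall>i<n. rho (r $ i) (?p i) \<le> rho (r $ I) (?p I)" "\<forall>j<n. rho (c $ j) (?q j) \<le> rho (c $ J) (?q J)"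
      "if rho (r $ I) (?p I) > rho (c $ J) (?q J)
       then u' = update_vec u I (u $ I + ln (r $ I) - ln (?p I)) \<and> v' = v
       else u' = u \<and> v' = update_vec v J (v $ J + ln (c $ J) - ln (?q J))"
      using st r(1) c(1) unfolding greenkhorn_step_def Let_def is_arg_max_linorder by (auto simp: sums)
    have "S.row_update I (\<lambda>i. u $ i) (\<lambda>j. v $ j) (\<lambda>i. u' $ i) (\<lambda>j. v' $ j)"
      if "rho (r $ I) (?p I) > rho (c $ J) (?q J)"
      using IJ that dim by (auto simp: S.row_update_def update_vec_def)
    moreover have "S.col_update J (\<lambda>i. u $ i) (\<lambda>j. v $ j) (\<lambda>i. u' $ i) (\<lambda>j. v' $ j)"
      if "\<not> rho (r $ I) (?p I) > rho (c $ J) (?q J)"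
      using IJ that dim by (auto simp: S.col_update_def update_vec_def)
    ultimately show ?thesis
      unfolding S.greedy_step_def using IJ(1-4) by (intro exI[of _ I] exI[of _ J]) auto
  qed
  obtain f where f: "f 0 = greenkhorn_start C" "\<And>t. t < T \<Longrightarrow> greenkhorn_iteration C \<eta> r c \<tau> (f t) (f (Suc t))"
    using chain by (auto simp: relpowp_fun_conv)
  have dims: "dim_vec (fst (f t)) = n \<and> dim_vec (snd (f t)) = n" if "t \<le> T" for t
  proof (rule greenkhorn_reachable_dims[OF _ Cc])
    show "(greenkhorn_iteration C \<eta> r c \<tau> ^^ t) (greenkhorn_start C) (f t)"
      unfolding relpowp_fun_conv using f that by (intro exI[of _ f]) auto
  qed
  show ?thesis
  proof (rule S.greedy_iteration_bound[OF n m R \<sigma>(1,2),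
        where us = "\<lambda>t i. fst (f t) $ i" and vs = "\<lambda>t j. snd (f t) $ j"])
    fix i assume "i < n"
    then show "fst (f 0) $ i = 0" "snd (f 0) $ i = 0"
      using Cc by (auto simp: f(1) greenkhorn_start_def)
  next
    fix t assume t: "t < T"
    show "S.greedy_step (($) (fst (f t))) (($) (snd (f t))) (($) (fst (f (Suc t)))) (($) (snd (f (Suc t))))"
      using f(2)[OF t] dims[of t] t by (intro step) (auto simp: greenkhorn_iteration_def)
    show "\<sigma> \<le> S.err (($) (fst (f t))) (($) (snd (f t)))"
      using f(2)[OF t] \<sigma>(3) by (simp add: greenkhorn_iteration_def err)
  qed
qed

lemma greenkhorn_iterations_bounded:
  assumes n: "2 \<le> n" and C: "C \<in> nonneg_mats n" and \<eta>: "0 < \<eta>"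
    and r: "r \<in> carrier_vec n" "positive_vec r" "(\<Sum>i<n. r $ i) = 1"
    and c: "c \<in> carrier_vec n" "positive_vec c" "(\<Sum>i<n. c $ i) = 1"
    and \<tau>: "0 < \<tau>"
  shows "\<exists>B. \<forall>t s. (greenkhorn_iteration C \<eta> r c \<tau> ^^ t) (greenkhorn_start C) s \<longrightarrow> t \<le> B"
proof -
  define m where "m = Min ((\<lambda>i. r $ i) ` {..<n} \<union> (\<lambda>i. c $ i) ` {..<n})"
  have m_le: "m \<le> r $ i" "m \<le> c $ i" if "i < n" for i
    using that by (auto simp: m_def)
  have "0 < m"
    unfolding m_def using n r c by (subst Min_gr_iff) (auto simp: positive_vec_def)
  define R where "R = max 1 (max_entry C / \<eta> - ln m)"
  define B where "B = 64 * real n * ln (real n) + 512 * real n * R / min \<tau> 2"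
  have "t \<le> nat \<lceil>B\<rceil>" if "(greenkhorn_iteration C \<eta> r c \<tau> ^^ t) (greenkhorn_start C) s" for t s
  proof -
    have "real t \<le> B"
      unfolding B_def using \<tau> that
      by (intro greenkhorn_iterations_bound[OF n C \<eta> r c \<open>0 < m\<close> m_le, of R "min \<tau> 2" \<tau> t s])
        (auto simp: R_def)
    then show ?thesis
      by linarith
  qed
  then show ?thesis
    by blast
qed

section \<open>Correctness and cost of the program\<close>

lemma counted_simps:
  "bind_counted (x, k) f = (fst (f x), k + snd (f x))"
  "ret x = (x, 0)" "op1 g x = (g x, 1)" "op2 h x y = (h x y, 1)"
  by (simp_all add: bind_counted_def ret_def op1_def op2_def)

lemma sum_prog_eq: "sum_prog n f = (\<Sum>i<n. fst (f i), (\<Sum>i<n. snd (f i)) + n)"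
  unfolding sum_prog_def
  by (induction n) (simp_all add: bind_counted_def ret_def op2_def)

lemma row_sums_prog_eq:
  "F \<in> carrier_mat n n \<Longrightarrow> row_sums_prog n F = (row_sums F, n * n)"
  by (auto simp: row_sums_prog_def tabulate_vec_def sum_prog_eq ret_def row_sums_index intro!: eq_vecI)

lemma col_sums_prog_eq:
  "F \<in> carrier_mat n n \<Longrightarrow> col_sums_prog n F = (col_sums F, n * n)"
  by (auto simp: col_sums_prog_def tabulate_vec_def sum_prog_eq ret_def col_sums_index intro!: eq_vecI)

lemma kernel_entry_prog_eq:
  "kernel_entry_prog C \<eta> u v i j = (exp (u $ i + v $ j - C $$ (i, j) / \<eta>), 4)"
  by (simp add: kernel_entry_prog_def counted_simps)

lemma rho_prog_eq: "rho_prog a b = (rho a b, 5)"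
  by (simp add: rho_prog_def counted_simps rho_def)

lemma error_prog_eq:
  assumes "F \<in> carrier_mat n n" and "r \<in> carrier_vec n" and "c \<in> carrier_vec n"
  shows "error_prog n r c (row_sums F) (col_sums F) = (marginal_error F r c, 6 * n + 1)"
  using assms
  by (simp add: error_prog_def dist1_prog_def sum_prog_eq counted_simps marginal_error_def norm1_def)

lemma max_entry_prog_eq:
  assumes "C \<in> carrier_mat n n" and "0 < n"
  shows "max_entry_prog n C = (max_entry C, n * n)"
proof -
  have inner: "for_loop k (\<lambda>j m. max_op m (g j)) s = (Max (insert s (g ` {..<k})), k)"
    for k g and s :: real
  proof (induction k)
    case (Suc k)
    have "Max (insert s (g ` {..<Suc k})) = Max (insert (g k) (insert s (g ` {..<k})))"
      by (simp add: lessThan_Suc insert_commute)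
    also have "\<dots> = max (Max (insert s (g ` {..<k}))) (g k)"
      by (subst Max_insert) (auto simp: max.commute)
    finally show ?case
      by (simp add: Suc bind_counted_def) (simp add: op2_def)
  qed (simp add: ret_def)
  have outer: "for_loop k (\<lambda>i. for_loop n (\<lambda>j m. max_op m (C $$ (i, j)))) s =
      (Max (insert s (\<Union>i<k. (\<lambda>j. C $$ (i, j)) ` {..<n})), k * n)" for k s
  proof (induction k)
    case (Suc k)
    let ?A = "insert s (\<Union>i<k. (\<lambda>j. C $$ (i, j)) ` {..<n})" and ?B = "(\<lambda>j. C $$ (k, j)) ` {..<n}"
    have "Max (insert (Max ?A) ?B) = max (Max ?A) (Max ?B)"
      using assms(2) by (subst Max_insert) auto
    also have "\<dots> = Max (?A \<union> ?B)"
      using assms(2) by (intro Max_Un[symmetric]) auto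
    also have "?A \<union> ?B = insert s (\<Union>i<Suc k. (\<lambda>j. C $$ (i, j)) ` {..<n})"
      by (auto simp: lessThan_Suc)
    finally show ?case
      by (simp only: for_loop.simps Suc bind_counted_def) (simp add: inner)
  qed (simp add: ret_def)
  have "insert (C $$ (0, 0)) (\<Union>i<n. (\<lambda>j. C $$ (i, j)) ` {..<n}) = elements_mat C"
    using assms by (auto simp: elements_mat_def atLeast0LessThan)
  then show ?thesis
    by (simp add: max_entry_prog_def outer max_entry_def)
qed

lemma argmax_prog_cost: "snd (argmax_prog tie n x) = 2 * n"
proof -
  have "snd (for_loop k (\<lambda>i best. bind_counted (less_op (x $ best) (x $ i)) (\<lambda>gt.
      bind_counted (eq_op (x $ best) (x $ i)) (\<lambda>eq. ret (if gt \<or> eq \<and> tie i then i else best)))) s) = 2 * k"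
    for k s
    by (induction k) (simp_all add: bind_counted_def ret_def op2_def)
  then show ?thesis
    by (simp add: argmax_prog_def)
qed

lemma argmax_prog_correct:
  assumes "0 < n"
  shows "is_arg_max (\<lambda>i. x $ i) (\<lambda>i. i < n) (fst (argmax_prog tie n x))"
proof -
  let ?f = "\<lambda>k. fst (for_loop k (\<lambda>i best. bind_counted (less_op (x $ best) (x $ i)) (\<lambda>gt.
      bind_counted (eq_op (x $ best) (x $ i)) (\<lambda>eq. ret (if gt \<or> eq \<and> tie i then i else best)))) 0)"
  \<comment> \<open>The search starts from candidate 0 before any index has been inspected, so
    \<open>?f k < k\<close> can only hold from \<open>k = 1\<close> on.\<close>
  have *: "if k = 0 then ?f k = 0 else ?f k < k \<and> (\<forall>i<k. x $ i \<le> x $ (?f k))" for k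
  proof (induction k)
    case (Suc k)
    have step: "?f (Suc k) = (if x $ (?f k) < x $ k \<or> x $ (?f k) = x $ k \<and> tie k then k else ?f k)"
      by (simp add: bind_counted_def ret_def op2_def)
    show ?case
      using Suc.IH unfolding step by (auto simp: less_Suc_eq split: if_splits)
  qed (simp add: ret_def)
  have "?f n < n \<and> (\<forall>i<n. x $ i \<le> x $ (?f n))"
    using *[of n] unfolding if_not_P[OF gr_implies_not0[OF assms]] .
  then show ?thesis
    unfolding is_arg_max_linorder argmax_prog_def by auto
qed

text \<open>The state invariant in functional form: \<open>t\<close>, \<open>u\<close> and
  \<open>v\<close> determine all other components. The update lemmas then say that incremental
  maintenance gives exactly the recomputed values.\<close>

definition gk_state_of ::
  "real mat \<Rightarrow> real \<Rightarrow> real vec \<Rightarrow> real vec \<Rightarrow> nat \<Rightarrow> real vec \<Rightarrow> real vec \<Rightarrow> gk_state" where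
  "gk_state_of C \<eta> r c t u v =
    (let F = scaled_kernel C \<eta> u v in (t, u, v, F, row_sums F, col_sums F, marginal_error F r c))"

section \<open>The Greenkhorn loop\<close>

context
  fixes n :: nat and C :: "real mat" and \<eta> :: real and r c :: "real vec"
  assumes n: "0 < n" and C: "C \<in> carrier_mat n n"
    and r: "r \<in> carrier_vec n" and c: "c \<in> carrier_vec n"
begin

lemma gk_init_eq:
  "gk_init n C \<eta> r c = (gk_state_of C \<eta> r c 0 (0\<^sub>v n) (0\<^sub>v n), 6 * (n * n) + 6 * n + 1)"
proof -
  have K: "tabulate_mat n n (kernel_entry_prog C \<eta> (0\<^sub>v n) (0\<^sub>v n)) =
      (scaled_kernel C \<eta> (0\<^sub>v n) (0\<^sub>v n), 4 * (n * n))"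
    using C by (auto simp: tabulate_mat_def kernel_entry_prog_eq scaled_kernel_def intro!: eq_matI)
  show ?thesis
    by (simp add: gk_init_def K counted_simps gk_state_of_def Let_def row_sums_prog_eq[OF scaled_kernel_carrier[OF C]]
        col_sums_prog_eq[OF scaled_kernel_carrier[OF C]] error_prog_eq[OF scaled_kernel_carrier[OF C] r c])
qed

text \<open>Only one row of the kernel changes, so each column sum is corrected by a single entry.
  The count is 4 for the new potential, \<open>4 * n\<close> for the row, \<open>n\<close> for its
  sum, \<open>2 * n\<close> for the column sums and \<open>6 * n + 1\<close> for the error.\<close>

lemma gk_row_update_eq:
  fixes u v :: "real vec"
  assumes u: "dim_vec u = n" and I: "I < n"
  defines "u' \<equiv> update_vec u I (u $ I + ln (r $ I) - ln (row_sums (scaled_kernel C \<eta> u v) $ I))"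
  shows "gk_row_update n C \<eta> r c I (gk_state_of C \<eta> r c t u v) =
    (gk_state_of C \<eta> r c (Suc t) u' v, 13 * n + 5)"
proof -
  define F where "F = scaled_kernel C \<eta> u v"
  define F' where "F' = scaled_kernel C \<eta> u' v"
  define x where "x = vec n (\<lambda>j. exp (u' $ I + v $ j - C $$ (I, j) / \<eta>))"
  have Fc: "F \<in> carrier_mat n n" "F' \<in> carrier_mat n n"
    using C by (simp_all add: F_def F'_def)
  have F'I: "F' $$ (I, j) = x $ j" if "j < n" for j
    using that I by (simp add: F'_def x_def scaled_kernel_index[OF C])
  have F'other: "F' $$ (i, j) = F $$ (i, j)" if "i < n" "j < n" "i \<noteq> I" for i j
    using that by (simp add: F'_def F_def u'_def scaled_kernel_index[OF C])
  have x: "tabulate_vec n (kernel_entry_prog C \<eta> u' v I) = (x, 4 * n)"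
    by (simp add: tabulate_vec_def kernel_entry_prog_eq x_def)
  have F': "mat n n (\<lambda>(i, j). if i = I then x $ j else F $$ (i, j)) = F'"
    using Fc F'I F'other by (intro eq_matI) auto
  have p: "update_vec (row_sums F) I (\<Sum>j<n. x $ j) = row_sums F'"
    using Fc F'I F'other by (intro eq_vecI) (auto simp: update_vec_def row_sums_index)
  have q: "vec n (\<lambda>j. col_sums F $ j - F $$ (I, j) + x $ j) = col_sums F'"
  proof (rule eq_vecI)
    fix j assume "j < dim_vec (col_sums F')"
    then have j: "j < n"
      using Fc by simp
    have "(\<Sum>i<n. F' $$ (i, j)) = (\<Sum>i<n. F $$ (i, j)) - F $$ (I, j) + F' $$ (I, j)"
      using I j F'other by (intro sum_update_diff) auto
    then show "vec n (\<lambda>j. col_sums F $ j - F $$ (I, j) + x $ j) $ j = col_sums F' $ j"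
      using j Fc F'I by (simp add: col_sums_index)
  qed (use Fc in simp)
  have q': "tabulate_vec n (\<lambda>j. bind_counted (sub_op (col_sums F $ j) (F $$ (I, j))) (\<lambda>d. add_op d (x $ j))) =
      (col_sums F', 2 * n)"
    unfolding q[symmetric] by (simp add: tabulate_vec_def counted_simps)
  show ?thesis
    unfolding gk_row_update_def gk_state_of_def Let_def F_def[symmetric] F'_def[symmetric] prod.case
    unfolding counted_simps fst_conv snd_conv u'_def[unfolded F_def[symmetric], symmetric] x F' sum_prog_eq p q'[unfolded counted_simps fst_conv snd_conv]
      error_prog_eq[OF Fc(2) r c]
    by simp
qed

lemma gk_col_update_eq:
  fixes u v :: "real vec"
  assumes v: "dim_vec v = n" and J: "J < n"
  defines "v' \<equiv> update_vec v J (v $ J + ln (c $ J) - ln (col_sums (scaled_kernel C \<eta> u v) $ J))"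
  shows "gk_col_update n C \<eta> r c J (gk_state_of C \<eta> r c t u v) =
    (gk_state_of C \<eta> r c (Suc t) u v', 13 * n + 5)"
proof -
  define F where "F = scaled_kernel C \<eta> u v"
  define F' where "F' = scaled_kernel C \<eta> u v'"
  define x where "x = vec n (\<lambda>i. exp (u $ i + v' $ J - C $$ (i, J) / \<eta>))"
  have Fc: "F \<in> carrier_mat n n" "F' \<in> carrier_mat n n"
    using C by (simp_all add: F_def F'_def)
  have F'J: "F' $$ (i, J) = x $ i" if "i < n" for i
    using that J by (simp add: F'_def x_def scaled_kernel_index[OF C])
  have F'other: "F' $$ (i, j) = F $$ (i, j)" if "i < n" "j < n" "j \<noteq> J" for i j
    using that by (simp add: F'_def F_def v'_def scaled_kernel_index[OF C])
  have x: "tabulate_vec n (\<lambda>i. kernel_entry_prog C \<eta> u v' i J) = (x, 4 * n)"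
    by (simp add: tabulate_vec_def kernel_entry_prog_eq x_def)
  have F': "mat n n (\<lambda>(i, j). if j = J then x $ i else F $$ (i, j)) = F'"
    using Fc F'J F'other by (intro eq_matI) auto
  have q: "update_vec (col_sums F) J (\<Sum>i<n. x $ i) = col_sums F'"
    using Fc F'J F'other by (intro eq_vecI) (auto simp: update_vec_def col_sums_index)
  have p: "vec n (\<lambda>i. row_sums F $ i - F $$ (i, J) + x $ i) = row_sums F'"
  proof (rule eq_vecI)
    fix i assume "i < dim_vec (row_sums F')"
    then have i: "i < n"
      using Fc by simp
    have "(\<Sum>j<n. F' $$ (i, j)) = (\<Sum>j<n. F $$ (i, j)) - F $$ (i, J) + F' $$ (i, J)"
      using J i F'other by (intro sum_update_diff) auto
    then show "vec n (\<lambda>i. row_sums F $ i - F $$ (i, J) + x $ i) $ i = row_sums F' $ i"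
      using i Fc F'J by (simp add: row_sums_index)
  qed (use Fc in simp)
  have p': "tabulate_vec n (\<lambda>i. bind_counted (sub_op (row_sums F $ i) (F $$ (i, J))) (\<lambda>d. add_op d (x $ i))) =
      (row_sums F', 2 * n)"
    unfolding p[symmetric] by (simp add: tabulate_vec_def counted_simps)
  show ?thesis
    unfolding gk_col_update_def gk_state_of_def Let_def F_def[symmetric] F'_def[symmetric] prod.case
    unfolding counted_simps fst_conv snd_conv v'_def[unfolded F_def[symmetric], symmetric] x F' sum_prog_eq q p'[unfolded counted_simps fst_conv snd_conv]
      error_prog_eq[OF Fc(2) r c]
    by simp
qed

lemma gk_body_correct:
  assumes u: "dim_vec u = n" and v: "dim_vec v = n"
  obtains u' v' where "greenkhorn_step C \<eta> r c (u, v) (u', v')"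
    and "gk_body row_tie col_tie n C \<eta> r c (gk_state_of C \<eta> r c t u v) =
      (gk_state_of C \<eta> r c (Suc t) u' v', 27 * n + 6)"
proof -
  define F where "F = scaled_kernel C \<eta> u v"
  have Fc: "F \<in> carrier_mat n n"
    using C by (simp add: F_def)
  define x where "x = vec n (\<lambda>i. rho (r $ i) (row_sums F $ i))"
  define y where "y = vec n (\<lambda>j. rho (c $ j) (col_sums F $ j))"
  have xp: "tabulate_vec n (\<lambda>i. rho_prog (r $ i) (row_sums F $ i)) = (x, 5 * n)"
    and yp: "tabulate_vec n (\<lambda>j. rho_prog (c $ j) (col_sums F $ j)) = (y, 5 * n)"
    by (simp_all add: tabulate_vec_def rho_prog_eq x_def y_def)
  define I where "I = fst (argmax_prog (row_tie t) n x)"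
  define J where "J = fst (argmax_prog (col_tie t) n y)"
  have Ip: "argmax_prog (row_tie t) n x = (I, 2 * n)" and Jp: "argmax_prog (col_tie t) n y = (J, 2 * n)"
    by (simp_all add: I_def J_def prod_eq_iff argmax_prog_cost)
  have I: "is_arg_max (\<lambda>i. rho (r $ i) (row_sums F $ i)) (\<lambda>i. i < dim_vec r) I"
    and J: "is_arg_max (\<lambda>j. rho (c $ j) (col_sums F $ j)) (\<lambda>j. j < dim_vec c) J"
    using argmax_prog_correct[OF n, of x "row_tie t"] argmax_prog_correct[OF n, of y "col_tie t"] r c
    unfolding is_arg_max_linorder I_def[symmetric] J_def[symmetric] by (auto simp: x_def y_def)
  then have IJ: "I < n" "J < n"
    using r c by (auto simp: is_arg_max_linorder)
  have b: "y $ J < x $ I \<longleftrightarrow> rho (c $ J) (col_sums F $ J) < rho (r $ I) (row_sums F $ I)"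
    using IJ by (simp add: x_def y_def)
  have body: "gk_body row_tie col_tie n C \<eta> r c (gk_state_of C \<eta> r c t u v) =
      (let s = if y $ J < x $ I then gk_row_update n C \<eta> r c I (gk_state_of C \<eta> r c t u v)
         else gk_col_update n C \<eta> r c J (gk_state_of C \<eta> r c t u v)
       in (fst s, 14 * n + 1 + snd s))"
    unfolding gk_body_def gk_state_of_def Let_def F_def[symmetric] prod.case
    unfolding counted_simps fst_conv snd_conv xp yp Ip Jp
    by (simp add: counted_simps)
  define u' where "u' = (if y $ J < x $ I then update_vec u I (u $ I + ln (r $ I) - ln (row_sums F $ I)) else u)"
  define v' where "v' = (if y $ J < x $ I then v else update_vec v J (v $ J + ln (c $ J) - ln (col_sums F $ J)))"
  have "greenkhorn_step C \<eta> r c (u, v) (u', v')"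
    unfolding greenkhorn_step_def Let_def prod.case F_def[symmetric]
    using I J by (intro exI[of _ I] exI[of _ J]) (auto simp: u'_def v'_def b)
  moreover have "gk_body row_tie col_tie n C \<eta> r c (gk_state_of C \<eta> r c t u v) =
      (gk_state_of C \<eta> r c (Suc t) u' v', 27 * n + 6)"
    unfolding body using gk_row_update_eq[OF u IJ(1), of t v] gk_col_update_eq[OF v IJ(2), of t u]
    by (simp add: u'_def v'_def F_def)
  ultimately show ?thesis
    by (rule that)
qed

theorem greenkhorn_prog_correct:
  assumes B: "\<And>t s. (greenkhorn_iteration C \<eta> r c \<tau> ^^ t) (greenkhorn_start C) s \<Longrightarrow> t \<le> B"
  obtains u v t k where
    "greenkhorn_prog row_tie col_tie n C \<eta> r c \<tau> = Some (scaled_kernel C \<eta> u v, k)"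
    "(greenkhorn_iteration C \<eta> r c \<tau> ^^ t) (greenkhorn_start C) (u, v)"
    "marginal_error (scaled_kernel C \<eta> u v) r c \<le> \<tau>"
    "k \<le> 6 * (n * n) + 6 * n + 2 + t * (27 * n + 7)"
proof -
  let ?it = "greenkhorn_iteration C \<eta> r c \<tau>"
  define b :: "gk_state \<Rightarrow> bool counted" where "b = (\<lambda>(t, u, v, F, p, q, e). less_op \<tau> e)"
  define f where "f = gk_body row_tie col_tie n C \<eta> r c"
  \<comment> \<open>Each round costs \<open>27 * n + 6\<close> for the body and 1 for the test.
    Carrying \<open>t\<close> in the state ties the cost to the length of an abstract run, which is
    bounded by \<open>B\<close>.\<close>
  define P where "P = (\<lambda>(s, k). \<exists>t u v. s = gk_state_of C \<eta> r c t u v \<and>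
    (?it ^^ t) (greenkhorn_start C) (u, v) \<and> k \<le> t * (27 * n + 7))"
  define cond where "cond = (\<lambda>(s, k::nat). fst (b s))"
  define step where "step = (\<lambda>(s, k). (fst (f s), k + snd (b s) + snd (f s)))"
  have b_eq: "b (gk_state_of C \<eta> r c t u v) = (\<tau> < marginal_error (scaled_kernel C \<eta> u v) r c, 1)" for t u v
    by (simp add: b_def gk_state_of_def Let_def op2_def)
  have dims: "dim_vec u = n" "dim_vec v = n" if "(?it ^^ t) (greenkhorn_start C) (u, v)" for t u v
    using greenkhorn_reachable_dims[OF that C] by auto
  have P_step: "P (step x) \<and> B - fst (fst (step x)) < B - fst (fst x)" if x: "P x" "cond x" for x
  proof -
    obtain t u v k where x_eq: "x = (gk_state_of C \<eta> r c t u v, k)"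
      and it: "(?it ^^ t) (greenkhorn_start C) (u, v)" and k: "k \<le> t * (27 * n + 7)"
      using x(1) by (auto simp: P_def)
    obtain u' v' where st: "greenkhorn_step C \<eta> r c (u, v) (u', v')"
      and body: "f (gk_state_of C \<eta> r c t u v) = (gk_state_of C \<eta> r c (Suc t) u' v', 27 * n + 6)"
      unfolding f_def by (rule gk_body_correct[OF dims[OF it]])
    have "?it (u, v) (u', v')"
      using st x(2) by (simp add: greenkhorn_iteration_def cond_def x_eq b_eq)
    then have it': "(?it ^^ Suc t) (greenkhorn_start C) (u', v')"
      using it by auto
    have step_x: "step x = (gk_state_of C \<eta> r c (Suc t) u' v', k + 1 + (27 * n + 6))"
      by (simp add: step_def x_eq b_eq body)
    have "P (step x)"
      unfolding P_def step_x prod.case using it' k by (intro exI[of _ "Suc t"] exI[of _ u'] exI[of _ v']) simp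
    \<comment> \<open>Subtraction on naturals is truncated; the decrease is strict because the
      extended run still satisfies \<open>Suc t \<le> B\<close>.\<close>
    moreover have "B - fst (fst (step x)) < B - fst (fst x)"
      using B[OF it'] unfolding step_x unfolding x_eq by (simp add: gk_state_of_def Let_def)
    ultimately show ?thesis ..
  qed
  define s0 where "s0 = gk_state_of C \<eta> r c 0 (0\<^sub>v n) (0\<^sub>v n)"
  have P0: "P (s0, 0)"
    unfolding P_def s0_def prod.case
    using C by (intro exI[of _ 0] exI[of _ "0\<^sub>v n"] conjI) (auto simp: greenkhorn_start_def)
  obtain x where x: "while_option cond step (s0, 0) = Some x"
    using measure_while_option_Some[of P cond step "\<lambda>x. B - fst (fst x)", OF P_step P0] by blast
  have "P x"
    using while_option_rule[of P cond step, OF _ x P0] P_step by blast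
  then obtain t u v k where x_eq: "x = (gk_state_of C \<eta> r c t u v, k)"
    and it: "(?it ^^ t) (greenkhorn_start C) (u, v)" and k: "k \<le> t * (27 * n + 7)"
    by (auto simp: P_def)
  have "\<not> cond x"
    by (rule while_option_stop[OF x])
  then have small: "marginal_error (scaled_kernel C \<eta> u v) r c \<le> \<tau>"
    by (simp add: cond_def x_eq b_eq)
  \<comment> \<open>The additional 1 is the failing test that ends the loop.\<close>
  have "while_loop b f s0 = Some (gk_state_of C \<eta> r c t u v, k + 1)"
    unfolding while_loop_def cond_def[symmetric] step_def[symmetric] x by (simp add: x_eq b_eq)
  then have "greenkhorn_prog row_tie col_tie n C \<eta> r c \<tau> =
      Some (scaled_kernel C \<eta> u v, 6 * (n * n) + 6 * n + 1 + (k + 1))"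
    unfolding greenkhorn_prog_def gk_init_eq Let_def prod.case b_def[symmetric] f_def[symmetric] s0_def[symmetric]
    by (simp add: gk_state_of_def Let_def)
  then show ?thesis
    using it small k by (intro that[of u v _ t]) auto
qed

end

lemma round_prog_correct:
  assumes F: "F \<in> carrier_mat n n" and r: "r \<in> carrier_vec n" and c: "c \<in> carrier_vec n"
  obtains k where "round_prog n r c F = (round_to r c F, k)" and "k \<le> 9 * (n * n) + 8 * n + 1"
proof -
  define F' where "F' = mat n n (\<lambda>(i, j). min (r $ i / row_sums F $ i) 1 * F $$ (i, j))"
  define F'' where "F'' = mat n n (\<lambda>(i, j). F' $$ (i, j) * min (c $ j / col_sums F' $ j) 1)"
  have Fc: "F' \<in> carrier_mat n n" "F'' \<in> carrier_mat n n"
    by (simp_all add: F'_def F''_def)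
  have x: "tabulate_vec n (\<lambda>i. bind_counted (div_op (r $ i) (row_sums F $ i)) (\<lambda>d. min_op d 1)) =
      (vec n (\<lambda>i. min (r $ i / row_sums F $ i) 1), 2 * n)"
    by (simp add: tabulate_vec_def counted_simps)
  have y: "tabulate_vec n (\<lambda>j. bind_counted (div_op (c $ j) (col_sums F' $ j)) (\<lambda>d. min_op d 1)) =
      (vec n (\<lambda>j. min (c $ j / col_sums F' $ j) 1), 2 * n)"
    by (simp add: tabulate_vec_def counted_simps)
  have t1: "tabulate_mat n n (\<lambda>i j. mul_op (vec n (\<lambda>i. min (r $ i / row_sums F $ i) 1) $ i) (F $$ (i, j))) = (F', n * n)"
    by (auto simp: tabulate_mat_def op2_def F'_def intro!: eq_matI)
  have t2: "tabulate_mat n n (\<lambda>i j. mul_op (F' $$ (i, j)) (vec n (\<lambda>j. min (c $ j / col_sums F' $ j) 1) $ j)) = (F'', n * n)"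
    by (auto simp: tabulate_mat_def op2_def F''_def intro!: eq_matI)
  define er where "er = r - row_sums F''"
  define ec where "ec = c - col_sums F''"
  have erp: "tabulate_vec n (\<lambda>i. sub_op (r $ i) (row_sums F'' $ i)) = (er, n)"
    and ecp: "tabulate_vec n (\<lambda>j. sub_op (c $ j) (col_sums F'' $ j)) = (ec, n)"
    using Fc r c by (auto simp: tabulate_vec_def op2_def er_def ec_def intro!: eq_vecI)
  have s: "sum_prog n (\<lambda>i. abs_op (er $ i)) = (norm1 er, 2 * n)"
    using Fc by (simp add: sum_prog_eq op1_def norm1_def er_def)
  define G where "G = mat n n (\<lambda>(i, j). F'' $$ (i, j) + er $ i * ec $ j / norm1 er)"
  have G: "tabulate_mat n n (\<lambda>i j. bind_counted (mul_op (er $ i) (ec $ j))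
      (\<lambda>a. bind_counted (div_op a (norm1 er)) (\<lambda>b. add_op (F'' $$ (i, j)) b))) = (G, 3 * (n * n))"
    by (simp add: tabulate_mat_def counted_simps G_def)
  have res: "round_to r c F = (if norm1 er = 0 then F'' else G)"
    unfolding round_to_eq[OF F r c, folded F'_def, folded F''_def] er_def[symmetric] G_def
    using Fc r c by (auto simp: er_def ec_def intro!: eq_matI)
  have "round_prog n r c F =
      (if norm1 er = 0 then (F'', 6 * (n * n) + 8 * n + 1) else (G, 9 * (n * n) + 8 * n + 1))"
    unfolding round_prog_def row_sums_prog_eq[OF F] counted_simps fst_conv snd_conv x[unfolded counted_simps fst_conv snd_conv] t1[unfolded counted_simps fst_conv snd_conv] col_sums_prog_eq[OF Fc(1)]
      y[unfolded counted_simps fst_conv snd_conv] t2[unfolded counted_simps fst_conv snd_conv] row_sums_prog_eq[OF Fc(2)] col_sums_prog_eq[OF Fc(2)] erp[unfolded counted_simps fst_conv snd_conv] ecp[unfolded counted_simps fst_conv snd_conv]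
      s[unfolded counted_simps fst_conv snd_conv] G[unfolded counted_simps fst_conv snd_conv]
    by simp
  then show ?thesis
    by (intro that[of "if norm1 er = 0 then 6 * (n * n) + 8 * n + 1 else 9 * (n * n) + 8 * n + 1"])
      (auto simp: res)
qed

section \<open>Set-up and the total operation count\<close>

lemma ot_smooth_carrier: "r \<in> carrier_vec n \<Longrightarrow> ot_smooth C \<epsilon> r \<in> carrier_vec n"
  by (intro carrier_vecI) (simp add: ot_smooth_def ones_def)

lemma setup_prog_eq:
  assumes C: "C \<in> carrier_mat n n" and n: "0 < n" and r: "r \<in> prob_simplex n" and c: "c \<in> prob_simplex n"
  shows "setup_prog n C r c \<epsilon> =
    ((ot_eta C \<epsilon>, ot_smooth C \<epsilon> r, ot_smooth C \<epsilon> c, ot_eps C \<epsilon> / 2), n * n + 4 * n + 10)"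
proof -
  have "tabulate_vec n (\<lambda>i. bind_counted (mul_op (1 - ot_eps C \<epsilon> / 8) (x $ i))
      (\<lambda>a. add_op a (ot_eps C \<epsilon> / (8 * real n)))) = (ot_smooth C \<epsilon> x, 2 * n)"
    if "x \<in> prob_simplex n" for x
  proof -
    have "dim_vec (ot_smooth C \<epsilon> x) = n"
      using ot_smooth_carrier[of x n C \<epsilon>] that by (simp add: prob_simplex_def)
    then show ?thesis
      using that by (auto simp: tabulate_vec_def counted_simps ot_smooth_index intro!: eq_vecI)
  qed
  note smooth = this[OF r] this[OF c]
  have dim: "dim_row C = n"
    using C by simp
  show ?thesis
    unfolding setup_prog_def counted_simps fst_conv snd_conv max_entry_prog_eq[OF C n]
      ot_eps_def[symmetric] smooth[unfolded counted_simps fst_conv snd_conv]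
    by (simp add: ot_eta_def dim)
qed

text \<open>Here \<kappa> stands for \<open>max_entry C / \<epsilon>\<close>, \<open>L\<close> for
  \<open>ln n\<close> and \<open>N\<close> for \<open>n\<close>. The lower bounds for \<kappa> and
  \<open>L\<close> allow all lower-order terms to be absorbed into the leading one.\<close>

lemma iteration_bound_arith:
  fixes \<kappa> L N :: real and t :: nat
  assumes \<kappa>: "1 / 64 \<le> \<kappa>" and L: "1 / 2 \<le> L" and N: "2 \<le> N"
    and t: "real t \<le> 64 * N * L + 512 * N * (4 * \<kappa> * L + 64 * \<kappa> + L) / (1 / (32 * \<kappa>))"
    and k: "real k \<le> 16 * N\<^sup>2 + 18 * N + 13 + real t * (27 * N + 7)"
  shows "real k \<le> 200000000 * (N\<^sup>2 * \<kappa>\<^sup>2 * L)"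
proof -
  have 1: "1 \<le> 64 * \<kappa>"
    using \<kappa> by simp
  have one_le: "1 \<le> 4096 * \<kappa>\<^sup>2"
    using power_mono[OF 1, of 2] by (simp add: power_mult_distrib)
  have KL: "0 < \<kappa>" "0 \<le> \<kappa> * L" "\<kappa> \<le> 2 * (\<kappa> * L)" "L \<le> 64 * (\<kappa> * L)"
    using \<kappa> L mult_left_mono[OF L, of \<kappa>] mult_right_mono[OF 1, of L] by auto
  \<comment> \<open>196 = 4 + 128 + 64, using \<open>1 \<le> 2 * L\<close> for the second term and
    \<open>1 \<le> 64 * \<kappa>\<close> for the third.\<close>
  have "4 * \<kappa> * L + 64 * \<kappa> + L \<le> 196 * (\<kappa> * L)"
    using KL by linarith
  then have "512 * N * (4 * \<kappa> * L + 64 * \<kappa> + L) * (32 * \<kappa>) \<le> 512 * N * (196 * (\<kappa> * L)) * (32 * \<kappa>)"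
    using KL N by (intro mult_right_mono mult_left_mono) auto
  moreover have "64 * N * L * 1 \<le> 64 * N * L * (4096 * \<kappa>\<^sup>2)"
    using one_le N L by (intro mult_left_mono) auto
  \<comment> \<open>3473408 = 512 * 196 * 32 + 64 * 4096.\<close>
  ultimately have t': "real t \<le> 3473408 * (N * \<kappa>\<^sup>2 * L)"
    using t by (simp add: power2_eq_square algebra_simps)
  have "real t * (27 * N + 7) \<le> 3473408 * (N * \<kappa>\<^sup>2 * L) * (31 * N)"
    using t' N L by (intro mult_mono) auto
  moreover have "16 * N\<^sup>2 + 18 * N + 13 \<le> 29 * N\<^sup>2"
  proof -
    have "2 * N \<le> N\<^sup>2" "4 \<le> N\<^sup>2"
      using N mult_right_mono[OF N, of N] power_mono[OF N, of 2] by (auto simp: power2_eq_square)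
    then show ?thesis
      by linarith
  qed
  moreover have "29 * N\<^sup>2 * 1 \<le> 29 * N\<^sup>2 * (8192 * (\<kappa>\<^sup>2 * L))"
  proof -
    have "1 / 2 * 1 \<le> L * (4096 * \<kappa>\<^sup>2)"
      using one_le L by (intro mult_mono) auto
    then show ?thesis
      by (intro mult_left_mono) (auto simp: mult.commute)
  qed
  moreover have "0 \<le> N\<^sup>2 * \<kappa>\<^sup>2 * L"
    using L by simp
  ultimately show ?thesis
    using k by (simp add: power2_eq_square algebra_simps)
qed

context
  fixes n :: nat and C :: "real mat" and r c :: "real vec" and \<epsilon> :: real
  assumes n: "2 \<le> n" and C: "C \<in> nonneg_mats n" and M: "0 < max_entry C"
    and r: "r \<in> prob_simplex n" and c: "c \<in> prob_simplex n" and \<epsilon>: "0 < \<epsilon>"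
    and pos: "positive_vec (ot_smooth C \<epsilon> r)" "positive_vec (ot_smooth C \<epsilon> c)"
begin

private abbreviation (input) "ot_iteration \<equiv>
  greenkhorn_iteration C (ot_eta C \<epsilon>) (ot_smooth C \<epsilon> r) (ot_smooth C \<epsilon> c) (ot_eps C \<epsilon> / 2)"

private lemma params:
  shows "0 < ot_eta C \<epsilon>" and "0 < ot_eps C \<epsilon>"
    and "ot_smooth C \<epsilon> r \<in> carrier_vec n" and "ot_smooth C \<epsilon> c \<in> carrier_vec n"
    and "(\<Sum>i<n. ot_smooth C \<epsilon> r $ i) = 1" and "(\<Sum>i<n. ot_smooth C \<epsilon> c $ i) = 1"
proof -
  show "0 < ot_eta C \<epsilon>"
    using C n \<epsilon> by (auto simp: ot_eta_def nonneg_mats_def)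
  show "0 < ot_eps C \<epsilon>"
    using M \<epsilon> by (simp add: ot_eps_def)
  show "ot_smooth C \<epsilon> r \<in> carrier_vec n" "ot_smooth C \<epsilon> c \<in> carrier_vec n"
    using r c by (auto simp: prob_simplex_def intro: ot_smooth_carrier)
  show "(\<Sum>i<n. ot_smooth C \<epsilon> r $ i) = 1" "(\<Sum>i<n. ot_smooth C \<epsilon> c $ i) = 1"
    using n sum_ot_smooth[OF r] sum_ot_smooth[OF c] by auto
qed

lemma ot_iterations_bounded: "\<exists>B. \<forall>t s. (ot_iteration ^^ t) (greenkhorn_start C) s \<longrightarrow> t \<le> B"
  using greenkhorn_iterations_bounded[OF n C params(1) params(3) pos(1) params(5) params(4) pos(2) params(6)]
    params(2) by simp

lemma ot_terminates:
  "greenkhorn_terminates C (ot_eta C \<epsilon>) (ot_smooth C \<epsilon> r) (ot_smooth C \<epsilon> c) (ot_eps C \<epsilon> / 2)"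
  unfolding greenkhorn_terminates_def
proof (rule notI, elim exE conjE)
  fix s
  assume s: "s 0 = greenkhorn_start C" "\<forall>t. ot_iteration (s t) (s (Suc t))"
  obtain B where B: "\<And>t s. (ot_iteration ^^ t) (greenkhorn_start C) s \<Longrightarrow> t \<le> B"
    using ot_iterations_bounded by blast
  have "(ot_iteration ^^ Suc B) (greenkhorn_start C) (s (Suc B))"
    unfolding relpowp_fun_conv using s by (intro exI[of _ s]) auto
  from B[OF this] show False
    by simp
qed

text \<open>The value of \<open>R\<close> is \<open>4 * \<kappa> * ln n\<close>, the largest cost
  over \<eta>, plus a bound for \<open>- ln m\<close>, where \<open>m\<close> is the uniform share
  of the smoothing. Estimating \<open>ln (64 * \<kappa>)\<close> by \<open>64 * \<kappa>\<close> is
  harmless, as the first term is already of order \<kappa> ln n.\<close>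

lemma ot_iterations_le:
  assumes small: "\<epsilon> \<le> 64 * max_entry C" and t: "(ot_iteration ^^ t) (greenkhorn_start C) s"
  defines "\<kappa> \<equiv> max_entry C / \<epsilon>"
  shows "real t \<le> 64 * real n * ln (real n) +
    512 * real n * (4 * \<kappa> * ln (real n) + 64 * \<kappa> + ln (real n)) / (1 / (32 * \<kappa>))"
proof (rule greenkhorn_iterations_bound[OF n C params(1) params(3) pos(1) params(5) params(4) pos(2) params(6)
      _ _ _ _ _ _ _ _ t])
  have \<kappa>: "1 / 64 \<le> \<kappa>" "0 < \<kappa>"
    using small M \<epsilon> by (auto simp: \<kappa>_def field_simps)
  have e: "ot_eps C \<epsilon> = 1 / (8 * \<kappa>)"
    using M \<epsilon> by (simp add: ot_eps_def \<kappa>_def)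
  have L: "0 < ln (real n)"
    using n by simp
  define m where "m = 1 / (64 * \<kappa> * real n)"
  show "0 < m"
    using \<kappa> n by (simp add: m_def)
  have m_le: "m \<le> ot_smooth C \<epsilon> x $ i" if "x \<in> prob_simplex n" "i < n" for x i
  proof -
    have "0 \<le> (1 - ot_eps C \<epsilon> / 8) * x $ i"
      using \<kappa> that by (intro mult_nonneg_nonneg) (auto simp: e prob_simplex_def field_simps)
    moreover have "ot_eps C \<epsilon> / (8 * real n) = m"
      by (simp add: e m_def)
    ultimately show ?thesis
      by (simp add: ot_smooth_index[OF that])
  qed
  show "m \<le> ot_smooth C \<epsilon> r $ i" "m \<le> ot_smooth C \<epsilon> c $ i" if "i < n" for i
    using m_le[OF r that] m_le[OF c that] .
  have "0 \<le> 4 * \<kappa> * ln (real n)"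
    using \<kappa> L by simp
  then show "1 \<le> 4 * \<kappa> * ln (real n) + 64 * \<kappa> + ln (real n)"
    using \<kappa>(1) L by linarith
  have "max_entry C / ot_eta C \<epsilon> = 4 * \<kappa> * ln (real n)"
    using C \<epsilon> by (auto simp: ot_eta_def \<kappa>_def nonneg_mats_def)
  moreover have "- ln m = ln (64 * \<kappa>) + ln (real n)"
    using \<kappa> n by (simp add: m_def ln_div ln_mult)
  moreover have "ln (64 * \<kappa>) \<le> 64 * \<kappa> - 1"
    using \<kappa> by (intro ln_le_minus_one) auto
  ultimately show "max_entry C / ot_eta C \<epsilon> - ln m \<le> 4 * \<kappa> * ln (real n) + 64 * \<kappa> + ln (real n)"
    by linarith
  \<comment> \<open>The tolerance is \<open>1 / (16 * \<kappa>)\<close>, which reaches 4 at \<kappa>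
    = 1/64; half of it never exceeds 2 in the admissible range.\<close>
  show "0 < 1 / (32 * \<kappa>)" "1 / (32 * \<kappa>) \<le> 2" "1 / (32 * \<kappa>) \<le> ot_eps C \<epsilon> / 2"
    using \<kappa> by (auto simp: e field_simps)
qed

lemma ot_prog_correct:
  obtains X k where "ot_prog row_tie col_tie n C r c \<epsilon> = Some (X, k)" and "X \<in> ot_outputs C r c \<epsilon>"
    and "\<epsilon> \<le> 64 * max_entry C \<Longrightarrow>
      real k \<le> 200000000 * ((real n)\<^sup>2 * (max_entry C)\<^sup>2 * ln (real n) / \<epsilon>\<^sup>2)"
proof -
  have n0: "0 < n" and Cc: "C \<in> carrier_mat n n" and rc: "r \<in> carrier_vec n" "c \<in> carrier_vec n"
    using n C r c by (auto simp: nonneg_mats_def prob_simplex_def)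
  obtain B where B: "\<And>t s. (ot_iteration ^^ t) (greenkhorn_start C) s \<Longrightarrow> t \<le> B"
    using ot_iterations_bounded by blast
  obtain u v t k where
    gk: "greenkhorn_prog row_tie col_tie n C (ot_eta C \<epsilon>) (ot_smooth C \<epsilon> r) (ot_smooth C \<epsilon> c)
      (ot_eps C \<epsilon> / 2) = Some (scaled_kernel C (ot_eta C \<epsilon>) u v, k)"
    and t: "(ot_iteration ^^ t) (greenkhorn_start C) (u, v)"
    and stop: "marginal_error (scaled_kernel C (ot_eta C \<epsilon>) u v) (ot_smooth C \<epsilon> r) (ot_smooth C \<epsilon> c)
      \<le> ot_eps C \<epsilon> / 2"
    and k: "k \<le> 6 * (n * n) + 6 * n + 2 + t * (27 * n + 7)"
    by (rule greenkhorn_prog_correct[OF n0 Cc params(3,4), of "ot_eta C \<epsilon>" "ot_eps C \<epsilon> / 2" B row_tie col_tie])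
      (use B in blast)+
  define F where "F = scaled_kernel C (ot_eta C \<epsilon>) u v"
  have Fc: "F \<in> carrier_mat n n"
    using Cc by (simp add: F_def)
  obtain k' where round: "round_prog n r c F = (round_to r c F, k')" and k': "k' \<le> 9 * (n * n) + 8 * n + 1"
    by (rule round_prog_correct[OF Fc rc])
  have "ot_prog row_tie col_tie n C r c \<epsilon> = Some (round_to r c F, n * n + 4 * n + 10 + k + k')"
    unfolding ot_prog_def setup_prog_eq[OF Cc n0 r c] Let_def prod.case gk
    by (simp add: F_def[symmetric] round)
  moreover have "round_to r c F \<in> ot_outputs C r c \<epsilon>"
    unfolding ot_outputs_def greenkhorn_outputs_def F_def
    using relpowp_imp_rtranclp[OF t] stop by blast
  moreover have "real (n * n + 4 * n + 10 + k + k') \<le>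
      200000000 * ((real n)\<^sup>2 * (max_entry C)\<^sup>2 * ln (real n) / \<epsilon>\<^sup>2)" if small: "\<epsilon> \<le> 64 * max_entry C"
  proof -
    have "n * n + 4 * n + 10 + k + k' \<le> 16 * (n * n) + 18 * n + 13 + t * (27 * n + 7)"
      using k k' by simp
    then have "real (n * n + 4 * n + 10 + k + k') \<le> real (16 * (n * n) + 18 * n + 13 + t * (27 * n + 7))"
      by (rule of_nat_mono)
    then have total: "real (n * n + 4 * n + 10 + k + k') \<le>
        16 * (real n)\<^sup>2 + 18 * real n + 13 + real t * (27 * real n + 7)"
      by (simp add: power2_eq_square)
    have "1 / 2 \<le> ln (2::real)"
      using ln_le_minus_one[of "1 / 2"] by (simp add: ln_div)
    also have "\<dots> \<le> ln (real n)"
      using n by simp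
    finally have L: "1 / 2 \<le> ln (real n)" .
    have "1 / 64 \<le> max_entry C / \<epsilon>"
      using small \<epsilon> by (simp add: field_simps)
    from iteration_bound_arith[OF this L _ ot_iterations_le[OF small t] total]
    show ?thesis
      using n by (simp add: power_divide)
  qed
  ultimately show ?thesis
    by (rule that)
qed

end

text \<open>Arbitrary tie rules stand for arbitrary choices among the maximisers. The cost estimate
  is confined to \<open>\<epsilon> \<le> 64 * max_entry C\<close> because for fixed \<open>n\<close>
  its right side tends to 0 as \<epsilon> grows, while reading the cost matrix already takes
  \<open>n * n\<close> operations.\<close>

theorem theorem3p6:
  shows "\<exists>K>0. \<forall>n C r c \<epsilon>.
    2 \<le> n \<and> C \<in> nonneg_mats n \<and> 0 < max_entry C \<and>
    r \<in> prob_simplex n \<and> c \<in> prob_simplex n \<and> 0 < \<epsilon> \<longrightarrow>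
      (\<forall>X \<in> ot_outputs C r c \<epsilon>.
         X \<in> nonneg_mats n \<and> X *\<^sub>v ones n = r \<and> transpose_mat X *\<^sub>v ones n = c \<and>
         (\<forall>X'. optimal_plan n C r c X' \<longrightarrow> mat_inner C X \<le> mat_inner C X' + \<epsilon>)) \<and>
      (positive_vec (ot_smooth C \<epsilon> r) \<and> positive_vec (ot_smooth C \<epsilon> c) \<longrightarrow>
         greenkhorn_terminates C (ot_eta C \<epsilon>) (ot_smooth C \<epsilon> r) (ot_smooth C \<epsilon> c) (ot_eps C \<epsilon> / 2) \<and>
         (\<forall>row_tie col_tie. \<exists>X k.
            ot_prog row_tie col_tie n C r c \<epsilon> = Some (X, k) \<and>
            X \<in> ot_outputs C r c \<epsilon> \<and>
            (\<epsilon> \<le> 64 * max_entry C \<longrightarrow>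
               real k \<le> K * ((real n)\<^sup>2 * (max_entry C)\<^sup>2 * ln (real n) / \<epsilon>\<^sup>2))))"
proof (intro exI[of _ 200000000] conjI allI impI ballI; (elim conjE)?)
  fix n C r c \<epsilon> X
  assume a: "2 \<le> n" "C \<in> nonneg_mats n" "0 < max_entry C" "r \<in> prob_simplex n" "c \<in> prob_simplex n"
    "0 < \<epsilon>" "X \<in> ot_outputs C r c \<epsilon>"
  note X = ot_outputs_correct[OF a]
  show "X \<in> nonneg_mats n" "X *\<^sub>v ones n = r" "transpose_mat X *\<^sub>v ones n = c"
    using X(1) by (auto simp: transport_plans_def)
  show "mat_inner C X \<le> mat_inner C X' + \<epsilon>" if "optimal_plan n C r c X'" for X'
    using that X(2) by (simp add: optimal_plan_def is_arg_min_def)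
next
  fix n C r c \<epsilon>
  assume a: "2 \<le> n" "C \<in> nonneg_mats n" "0 < max_entry C" "r \<in> prob_simplex n" "c \<in> prob_simplex n"
    "0 < \<epsilon>" "positive_vec (ot_smooth C \<epsilon> r)" "positive_vec (ot_smooth C \<epsilon> c)"
  show "greenkhorn_terminates C (ot_eta C \<epsilon>) (ot_smooth C \<epsilon> r) (ot_smooth C \<epsilon> c) (ot_eps C \<epsilon> / 2)"
    by (rule ot_terminates[OF a])
  show "\<exists>X k. ot_prog row_tie col_tie n C r c \<epsilon> = Some (X, k) \<and> X \<in> ot_outputs C r c \<epsilon> \<and>
      (\<epsilon> \<le> 64 * max_entry C \<longrightarrow>
        real k \<le> 200000000 * ((real n)\<^sup>2 * (max_entry C)\<^sup>2 * ln (real n) / \<epsilon>\<^sup>2))" for row_tie col_tie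
    by (rule ot_prog_correct[OF a, of row_tie col_tie]) blast
qed simp

end
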